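(* Let $\Gamma$ be a finite, irreducible Coxeter group of rank $k$ with Coxeter generators $S=\{s_1,\dots,s_k\}$, realised as a reflection group $\Gamma\hookrightarrow O(k)$, and let $\sigma_j\in O(k)$, $p_1,\dots,p_k\in\mathbb{R}^k$, $V>0$, $\mathcal{F}_0\subset S^{k-1}$, $\Delta$ and $P_X$ be as defined in the context. Then there exist smooth maps $\Psi_\Delta:\mathcal{F}_0\to\mathrm{int}(\Delta)$ and $\Psi_\lambda:\mathcal{F}_0\to(0,1)$, with $\Psi_\Delta$ bijective, such that, for every $p=\sum_j\alpha_jp_j\in\mathcal{F}_0$, the functions $\phi_i:\Gamma\to\mathbb{R}$, $\phi_i(\gamma):=\pi_i(\gamma p)$, $1\le i\le k$, are pairwise orthogonal eigenfunctions of $P_X$ on $\mathrm{Cay}(\Gamma,S)$ for the eigenvalue $\lambda=\Psi_\lambda(p)$, where $X=\Psi_\Delta(p)$. Moreover, $\|\phi_i\|^2=\frac{|\Gamma|}{k}$, and the composition $\Psi_\lambda\circ\Psi_\Delta^{-1}:\mathrm{int}(\Delta)\to(0,1)$ is analytic. The simultaneous evaluation $$\Phi:\Gamma\to S^{k-1},\qquad\Phi(\gamma)=(\phi_1(\gamma),\dots,\phi_k(\gamma))=\gamma p$$ is faithful (i.e. injective), and the Euclidean lengths of the images of the equivalence classes of edges under $\Phi$ are given by $$\|p-\sigma_j(p)\|=2\alpha_jV.$$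
   Context: $\Gamma=\langle s_1,\dots,s_k\mid(s_is_j)^{m_{ij}}=e\rangle$ is a finite irreducible Coxeter group of rank $k$, with $m_{ij}=m_{ji}\ge2$ for $i\ne j$ and $s_i^2=e$. $\Gamma\hookrightarrow O(k)$ is its geometric realisation as a finite reflection group: $s_j$ acts as the reflection $\sigma_j(v)=v-2\langle v,n_j\rangle n_j$, where the unit vectors $n_1,\dots,n_k$ are the simple roots, $\langle n_i,n_j\rangle=-\cos\frac{\pi}{m_{ij}}$ for $i\neq j$. Set $V=\det(n_1,\dots,n_k)$; the generators are ordered so that $V>0$. Let $$p_j=(-1)^{j-1}n_1\times\cdots\times\widehat{n_j}\times\cdots\times n_k$$ (the hat means that the term is omitted), where $v_1\times\cdots\times v_{k-1}$ denotes the $(k-1)$-ary analogue of the cross product in $\mathbb{R}^k$; thus $\langle n_i,p_j\rangle=V\delta_{ij}$. $S^{k-1}\subset\mathbb{R}^k$ is the unit sphere, $\mathcal{F}=\{\alpha_1p_1+\dots+\alpha_kp_k\mid\alpha_1,\dots,\alpha_k>0\}$ (a fundamental domain of the $\Gamma$-action on $\mathbb{R}^k$) and $\mathcal{F}_0=\mathcal{F}\cap S^{k-1}$. $\pi_i:\mathbb{R}^k\to\mathbb{R}$ is the projection to the $i$-th coordinate. $\Delta=\{(x_1,\dots,x_k)\mid x_j\ge0,\ \sum_jx_j=1\}$ and $\mathrm{int}(\Delta)$ is the subset where all $x_j>0$. $\mathrm{Cay}(\Gamma,S)$ has vertex set $\Gamma$ and edges $\{\gamma,\gamma s_j\}$;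 the equivalence classes of edges (under left multiplication by $\Gamma$) are indexed by $j\in\{1,\dots,k\}$. For $X=(x_1,\dots,x_k)\in\Delta$, $P_Xf(\gamma)=\sum_{j=1}^kx_jf(\gamma s_j)$ for $f:\Gamma\to\mathbb{R}$; the inner product is $\langle f,g\rangle=\sum_{\gamma\in\Gamma}f(\gamma)g(\gamma)$.
   Formalization: The rank is assumed to be k ≥ 2: for k = 1 (Γ = Z/2, X = (1)) the function φ_1 has eigenvalue −1, which is not in (0,1), so the statement fails there. *)

theory Defs
  imports "HOL-Analysis.Analysis" "HOL-Algebra.Generated_Groups"
begin

section \<open>Coxeter groups\<close>

text \<open>A letter \<open>(a, True)\<close> stands for the generator \<open>a\<close>, and \<open>(a, False)\<close> for its formal inverse.\<close>

type_synonym 'a gword = "('a \<times> bool) list"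

definition eval_letter :: "('g, 'b) monoid_scheme \<Rightarrow> ('a \<Rightarrow> 'g) \<Rightarrow> 'a \<times> bool \<Rightarrow> 'g" where
  "eval_letter G s l = (if snd l then s (fst l) else inv\<^bsub>G\<^esub> (s (fst l)))"

definition eval_word :: "('g, 'b) monoid_scheme \<Rightarrow> ('a \<Rightarrow> 'g) \<Rightarrow> 'a gword \<Rightarrow> 'g" where
  "eval_word G s w = foldr (\<lambda>l g. eval_letter G s l \<otimes>\<^bsub>G\<^esub> g) w \<one>\<^bsub>G\<^esub>"

inductive pres_eq :: "'a gword set \<Rightarrow> 'a gword \<Rightarrow> 'a gword \<Rightarrow> bool" for R where
  pres_refl: "pres_eq R u u"
| pres_sym: "pres_eq R u v \<Longrightarrow> pres_eq R v u"
| pres_trans: "pres_eq R u v \<Longrightarrow> pres_eq R v w \<Longrightarrow> pres_eq R u w"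
| pres_cancel: "pres_eq R (u @ [(a, b), (a, \<not> b)] @ v) (u @ v)"
| pres_relator: "r \<in> R \<Longrightarrow> pres_eq R (u @ r @ v) (u @ v)"

text \<open>\<open>G\<close>, with the elements \<open>s a\<close>, is the group with generators \<open>a\<close> and relators \<open>R\<close>.\<close>

definition has_presentation ::
    "('g, 'b) monoid_scheme \<Rightarrow> ('a \<Rightarrow> 'g) \<Rightarrow> 'a gword set \<Rightarrow> bool" where
  "has_presentation G s R \<longleftrightarrow>
     group G \<and> range s \<subseteq> carrier G \<and> generate G (range s) = carrier G \<and>
     (\<forall>u v. eval_word G s u = eval_word G s v \<longleftrightarrow> pres_eq R u v)"

text \<open>The diagonal entries of \<open>m\<close> are irrelevant: the relations \<open>s\<^sub>i\<^sup>2 = e\<close> are listed separately.\<close>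

definition coxeter_matrix :: "('k \<Rightarrow> 'k \<Rightarrow> nat) \<Rightarrow> bool" where
  "coxeter_matrix m \<longleftrightarrow> (\<forall>i j. i \<noteq> j \<longrightarrow> m i j = m j i \<and> 2 \<le> m i j)"

definition coxeter_relators :: "('k \<Rightarrow> 'k \<Rightarrow> nat) \<Rightarrow> 'k gword set" where
  "coxeter_relators m =
     {[(i, True), (i, True)] | i. True} \<union>
     {concat (replicate (m i j) [(i, True), (j, True)]) | i j. i \<noteq> j}"

definition coxeter_group :: "('g, 'b) monoid_scheme \<Rightarrow> ('k \<Rightarrow> 'g) \<Rightarrow> ('k \<Rightarrow> 'k \<Rightarrow> nat) \<Rightarrow> bool" where
  "coxeter_group G s m \<longleftrightarrow> coxeter_matrix m \<and> has_presentation G s (coxeter_relators m)"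

text \<open>Irreducibility: the Coxeter graph is connected.\<close>

definition coxeter_irreducible :: "('k \<Rightarrow> 'k \<Rightarrow> nat) \<Rightarrow> bool" where
  "coxeter_irreducible m \<longleftrightarrow> (\<forall>i j. (i, j) \<in> {(a, b). a \<noteq> b \<and> 3 \<le> m a b}\<^sup>*)"


section \<open>Geometric realisation\<close>

text \<open>The index type \<open>'k\<close> plays the role of \<open>{1, \<dots>, k}\<close>, both for the generators and for the
  coordinates of \<open>\<real>\<^sup>k\<close>.  Its linear order enters only through the order of the factors
  and the sign \<open>(-1)\<^sup>j\<^sup>-\<^sup>1\<close> in the definition of \<open>p\<^sub>j\<close>.\<close>

definition reflection :: "'a::real_inner \<Rightarrow> 'a \<Rightarrow> 'a" where
  "reflection n v = v - (2 * (v \<bullet> n)) *\<^sub>R n"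

definition simple_roots :: "('k \<Rightarrow> 'k \<Rightarrow> nat) \<Rightarrow> ('k \<Rightarrow> real ^ 'k) \<Rightarrow> bool" where
  "simple_roots m n \<longleftrightarrow>
     (\<forall>i. norm (n i) = 1) \<and> (\<forall>i j. i \<noteq> j \<longrightarrow> n i \<bullet> n j = - cos (pi / real (m i j)))"

definition orthogonal_group :: "('a::real_inner \<Rightarrow> 'a) monoid" where
  "orthogonal_group = \<lparr>carrier = {f. orthogonal_transformation f}, mult = (\<circ>), one = id\<rparr>"

definition geometric_realisation ::
    "('g, 'b) monoid_scheme \<Rightarrow> ('k \<Rightarrow> 'g) \<Rightarrow> ('k \<Rightarrow> real ^ 'k) \<Rightarrow> ('g \<Rightarrow> real ^ 'k \<Rightarrow> real ^ 'k) \<Rightarrow> bool"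
  where
  "geometric_realisation G s n \<rho> \<longleftrightarrow> \<rho> \<in> hom G orthogonal_group \<and> (\<forall>j. \<rho> (s j) = reflection (n j))"

definition root_det :: "('k::finite \<Rightarrow> real ^ 'k) \<Rightarrow> real" where
  "root_det n = det (\<chi> i j. n j $ i)"

definition pos :: "'k::{finite, linorder} \<Rightarrow> nat" where
  "pos j = card {i. i < j}"

text \<open>The product \<open>v\<^sub>1 \<times> \<dots> \<times> v\<^sub>k\<^sub>-\<^sub>1\<close> of a list of \<open>k - 1\<close> vectors: its \<open>i\<close>-th coordinate is the
  determinant with rows \<open>e\<^sub>i, v\<^sub>1, \<dots>, v\<^sub>k\<^sub>-\<^sub>1\<close>, so that its inner product with \<open>v\<close> is
  \<open>det (v, v\<^sub>1, \<dots>, v\<^sub>k\<^sub>-\<^sub>1)\<close>.\<close>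

definition cross_product ::
    "(real ^ ('k::{finite, linorder})) list \<Rightarrow> real ^ ('k::{finite, linorder})"
  where
  "cross_product vs = (\<chi> i. det (\<chi> r. (axis i 1 # vs) ! pos r))"

text \<open>\<open>pos\<close> counts from 0, so \<open>pos j\<close> is the exponent \<open>j - 1\<close>.\<close>

definition dual_vec ::
    "('k::{finite, linorder} \<Rightarrow> real ^ ('k::{finite, linorder})) \<Rightarrow>
      'k::{finite, linorder} \<Rightarrow> real ^ ('k::{finite, linorder})"
  where
  "dual_vec n j =
     (- 1) ^ pos j *\<^sub>R cross_product (map n (filter (\<lambda>i. i \<noteq> j) (sorted_list_of_set UNIV)))"

definition chamber ::
    "('k::{finite, linorder} \<Rightarrow> real ^ ('k::{finite, linorder})) \<Rightarrow> (real ^ ('k::{finite, linorder})) set"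
  where
  "chamber n = {\<Sum>j\<in>UNIV. \<alpha> j *\<^sub>R dual_vec n j | \<alpha>. \<forall>j. 0 < \<alpha> j}"

definition chamber0 ::
    "('k::{finite, linorder} \<Rightarrow> real ^ ('k::{finite, linorder})) \<Rightarrow> (real ^ ('k::{finite, linorder})) set"
  where
  "chamber0 n = chamber n \<inter> sphere 0 1"


section \<open>Weighted Cayley graphs\<close>

definition weights :: "(real ^ 'k) set" where
  "weights = {x. (\<forall>j. 0 \<le> x $ j) \<and> (\<Sum>j\<in>UNIV. x $ j) = 1}"

definition int_weights :: "(real ^ 'k) set" where
  "int_weights = {x \<in> weights. \<forall>j. 0 < x $ j}"

definition markov_op ::
    "('g, 'b) monoid_scheme \<Rightarrow> ('k \<Rightarrow> 'g) \<Rightarrow> real ^ 'k \<Rightarrow> ('g \<Rightarrow> real) \<Rightarrow> 'g \<Rightarrow> real" where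
  "markov_op G s x f \<gamma> = (\<Sum>j\<in>UNIV. x $ j * f (\<gamma> \<otimes>\<^bsub>G\<^esub> s j))"

text \<open>Functions on the group are functions on the type \<open>'g\<close> of which only the values on the carrier
  count.\<close>

definition eigenfunction ::
    "('g, 'b) monoid_scheme \<Rightarrow> (('g \<Rightarrow> real) \<Rightarrow> 'g \<Rightarrow> real) \<Rightarrow> real \<Rightarrow> ('g \<Rightarrow> real) \<Rightarrow> bool" where
  "eigenfunction G P l f \<longleftrightarrow>
     (\<exists>\<gamma>\<in>carrier G. f \<gamma> \<noteq> 0) \<and> (\<forall>\<gamma>\<in>carrier G. P f \<gamma> = l * f \<gamma>)"

definition fun_inner :: "('g, 'b) monoid_scheme \<Rightarrow> ('g \<Rightarrow> real) \<Rightarrow> ('g \<Rightarrow> real) \<Rightarrow> real" where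
  "fun_inner G f g = (\<Sum>\<gamma>\<in>carrier G. f \<gamma> * g \<gamma>)"

definition fun_norm :: "('g, 'b) monoid_scheme \<Rightarrow> ('g \<Rightarrow> real) \<Rightarrow> real" where
  "fun_norm G f = sqrt (fun_inner G f f)"

definition cayley_edge_class ::
    "('g, 'b) monoid_scheme \<Rightarrow> ('k \<Rightarrow> 'g) \<Rightarrow> 'k \<Rightarrow> 'g set set" where
  "cayley_edge_class G s j = {{\<gamma>, \<gamma> \<otimes>\<^bsub>G\<^esub> s j} | \<gamma>. \<gamma> \<in> carrier G}"


section \<open>Smooth and analytic maps on subsets of Euclidean space\<close>

primrec Ck_on ::
    "nat \<Rightarrow> 'a::euclidean_space set \<Rightarrow> ('a \<Rightarrow> 'b::real_normed_vector) \<Rightarrow> bool" where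
  "Ck_on 0 U f \<longleftrightarrow> continuous_on U f"
| "Ck_on (Suc r) U f \<longleftrightarrow>
     (\<forall>x\<in>U. f differentiable (at x)) \<and>
     (\<forall>v. Ck_on r U (\<lambda>x. frechet_derivative f (at x) v))"

text \<open>For a set \<open>A\<close> that need not be open, smoothness and analyticity mean that \<open>f\<close> extends locally
  to a smooth, respectively analytic, map on an open set of the ambient space.  For an embedded
  submanifold \<open>A\<close> (here an open subset of a sphere or of an affine hyperplane) this agrees with
  the definition by charts.\<close>

definition smooth_map_on ::
    "'a::euclidean_space set \<Rightarrow> ('a \<Rightarrow> 'b::real_normed_vector) \<Rightarrow> bool" where
  "smooth_map_on A f \<longleftrightarrow>
     (\<forall>a\<in>A. \<exists>U F. open U \<and> a \<in> U \<and> (\<forall>r. Ck_on r U F) \<and> (\<forall>x\<in>A \<inter> U. F x = f x))"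

text \<open>Expansion into an unconditionally (equivalently, absolutely) convergent power series in several
  variables, indexed by the multi-indices \<open>\<beta>\<close>.\<close>

definition real_analytic_at :: "(real ^ 'k \<Rightarrow> real) \<Rightarrow> real ^ 'k \<Rightarrow> bool" where
  "real_analytic_at F a \<longleftrightarrow>
     (\<exists>c :: ('k \<Rightarrow> nat) \<Rightarrow> real. \<exists>r>0. \<forall>x\<in>ball a r.
        ((\<lambda>\<beta>. c \<beta> * (\<Prod>i\<in>UNIV. (x $ i - a $ i) ^ \<beta> i)) has_sum F x) UNIV)"

definition analytic_map_on :: "(real ^ 'k) set \<Rightarrow> (real ^ 'k \<Rightarrow> real) \<Rightarrow> bool" where
  "analytic_map_on A f \<longleftrightarrow>
     (\<forall>a\<in>A. \<exists>U F. open U \<and> a \<in> U \<and> (\<forall>x\<in>U. real_analytic_at F x) \<and> (\<forall>x\<in>A \<inter> U. F x = f x))"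

end

theory Submission
  imports Defs
begin

text \<open>Let \<open>q\<^sub>1, \<dots>, q\<^sub>k\<close> be the basis dual to the simple roots, so that \<open>p\<^sub>j = V q\<^sub>j\<close>. Averaging the
  reflections with weights \<open>x\<close> gives \<open>1 - 2 T\<^sub>x\<close> with \<open>T\<^sub>x p = \<Sum>\<^sub>i x\<^sub>i \<langle>n\<^sub>i, p\<rangle> n\<^sub>i\<close>, so the coordinates of an
  orbit map \<open>\<gamma> \<mapsto> \<gamma> p\<close> are eigenfunctions for \<open>\<lambda> = 1 - 2 \<nu>\<close> as soon as \<open>T\<^sub>x p = \<nu> p\<close>, that is,
  \<open>x\<^sub>i \<langle>n\<^sub>i, p\<rangle> = \<nu> \<langle>q\<^sub>i, p\<rangle>\<close> for all \<open>i\<close>. This determines \<open>x\<close> and \<open>\<nu>\<close> as rational functions of \<open>p\<close>.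
  Conversely, irreducibility makes the Gram matrix of the \<open>q\<^sub>i\<close> entrywise positive, and by a
  Perron--Frobenius argument each positive \<open>x\<close> has exactly one unit eigenvector \<open>p\<close> in the chamber.
  Its eigenvalue is simple, hence analytic in \<open>x\<close>. Orthogonality and the norms come from Schur's
  lemma, and faithfulness is Tits's theorem that the chamber has trivial stabilisers.\<close>

section \<open>Smooth maps\<close>

text \<open>The inverse of the weight map has no closed formula, and \<open>int_weights\<close> lies
  in a hyperplane, whereas analyticity asks for power series on open subsets of the ambient space.
  The eigenvalue is therefore studied as a function of all positive weights, normalised or not: it
  is the only eigenvalue with an eigenvector in the chamber, and this singles it out on the whole
  open orthant. The eigenvalue equation is quadratic in the perturbation, so a power series solution
  is a fixed point of an affine-plus-bilinear map. A bound on the norm of that solution keeps the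
  perturbed eigenvector in the chamber, so that the eigenvalue it carries is again the distinguished
  one. From points to weights things are easier: the chamber is open in the ambient space and the
  rational formulas are smooth on all of it. That \<lambda> lies in (0,1) comes from each ratio of a
  dual coordinate of p to the corresponding root coordinate exceeding 1; with rank at least 2 the
  ratios sum to more than 2, and \<nu> is the reciprocal of that sum.\<close>

lemma Ck_on_cong:
  assumes "open U" "\<And>x. x \<in> U \<Longrightarrow> f x = g x" "Ck_on r U f"
  shows "Ck_on r U g"
  using assms(2,3)
proof (induction r arbitrary: f g)
  case 0
  then show ?case by (metis Ck_on.simps(1) continuous_on_cong)
next
  case (Suc r)
  have ev: "eventually (\<lambda>y. f y = g y) (nhds x)" if "x \<in> U" for x
    using Suc.prems(1) that assms(1) eventually_nhds by blast
  have D: "(g has_derivative frechet_derivative f (at x)) (at x)" if "x \<in> U" for x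
  proof (rule has_derivative_transform_within_open[OF _ assms(1) that])
    show "(f has_derivative frechet_derivative f (at x)) (at x)"
      using Suc.prems(2) that by (simp add: frechet_derivative_works[symmetric])
  qed (use Suc.prems(1) in auto)
  have eq: "frechet_derivative g (at x) = frechet_derivative f (at x)" if "x \<in> U" for x
    using D[OF that] frechet_derivative_at by metis
  have "Ck_on r U (\<lambda>x. frechet_derivative g (at x) v)" for v
    by (rule Suc.IH[of "\<lambda>x. frechet_derivative f (at x) v"]) (use Suc.prems eq in auto)
  then show ?case using D by (auto simp: differentiable_def)
qed

lemma Ck_on_SucI:
  assumes "open U" "\<And>x. x \<in> U \<Longrightarrow> (f has_derivative f' x) (at x)" "\<And>v. Ck_on r U (\<lambda>x. f' x v)"
  shows "Ck_on (Suc r) U f"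
proof -
  have "frechet_derivative f (at x) = f' x" if "x \<in> U" for x
    using assms(2)[OF that] frechet_derivative_at by metis
  then have "Ck_on r U (\<lambda>x. frechet_derivative f (at x) v)" for v
    by (intro Ck_on_cong[OF assms(1) _ assms(3)[of v]]) auto
  then show ?thesis using assms(2) by (auto simp: differentiable_def)
qed

lemma Ck_on_SucD: "Ck_on (Suc r) U f \<Longrightarrow> Ck_on r U f"
proof (induction r arbitrary: f)
  case 0
  then show ?case
    by (auto intro!: continuous_at_imp_continuous_on differentiable_imp_continuous_within)
next
  case (Suc r)
  then show ?case by (metis Ck_on.simps(2))
qed

lemma Ck_on_Suc_has_derivative:
  "Ck_on (Suc r) U f \<Longrightarrow> x \<in> U \<Longrightarrow> (f has_derivative frechet_derivative f (at x)) (at x)"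
  by (simp add: frechet_derivative_works[symmetric])

lemma Ck_on_const: "open U \<Longrightarrow> Ck_on r U (\<lambda>x. c)"
  by (induction r arbitrary: c) (auto intro: Ck_on_SucI[where f'="\<lambda>x v. 0"])

lemma Ck_on_linear:
  assumes "open U" "bounded_linear f"
  shows "Ck_on r U f"
proof (cases r)
  case 0
  then show ?thesis using assms(2) by (simp add: linear_continuous_on)
next
  case (Suc r')
  then show ?thesis
    using Ck_on_SucI[OF assms(1) bounded_linear_imp_has_derivative[OF assms(2)]] Ck_on_const[OF assms(1)]
    by blast
qed

lemma Ck_on_add:
  assumes "open U" "Ck_on r U f" "Ck_on r U g"
  shows "Ck_on r U (\<lambda>x. f x + g x)"
  using assms(2,3)
proof (induction r arbitrary: f g)
  case 0
  then show ?case by (simp add: continuous_on_add)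
next
  case (Suc r)
  show ?case
    by (rule Ck_on_SucI[OF assms(1) has_derivative_add[OF Suc.prems[THEN Ck_on_Suc_has_derivative]]])
       (use Suc in auto)
qed

lemma Ck_on_sum:
  assumes "open U" "finite I" "\<And>i. i \<in> I \<Longrightarrow> Ck_on r U (f i)"
  shows "Ck_on r U (\<lambda>x. \<Sum>i\<in>I. f i x)"
  using assms(2,3) by (induction I) (auto intro: Ck_on_const Ck_on_add assms(1))

text \<open>The Leibniz formula pairs each factor with a derivative of the other. The induction
  therefore varies both functions, and the undifferentiated factor is lowered by one class with
  \<open>Ck_on_SucD\<close>.\<close>

lemma (in bounded_bilinear) Ck_on:
  assumes "open U" "Ck_on r U f" "Ck_on r U g"
  shows "Ck_on r U (\<lambda>x. prod (f x) (g x))"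
  using assms(2,3)
proof (induction r arbitrary: f g)
  case 0
  then show ?case by (simp add: continuous_on)
next
  case (Suc r)
  show ?case
    by (rule Ck_on_SucI[OF assms(1) FDERIV[OF Suc.prems[THEN Ck_on_Suc_has_derivative]]])
       (use Suc Suc.prems[THEN Ck_on_SucD] in \<open>auto intro!: Ck_on_add[OF assms(1)] Suc.IH\<close>)
qed

lemmas Ck_on_mult = bounded_bilinear.Ck_on[OF bounded_bilinear_mult]
lemmas Ck_on_scaleR = bounded_bilinear.Ck_on[OF bounded_bilinear_scaleR]

text \<open>The derivative of 1/f contains 1/f again but only to lower order, so the induction on
  \<open>r\<close> can keep \<open>f\<close> fixed.\<close>

lemma Ck_on_inverse:
  fixes f :: "'a::euclidean_space \<Rightarrow> real"
  assumes "open U" "Ck_on r U f" "\<And>x. x \<in> U \<Longrightarrow> f x \<noteq> 0"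
  shows "Ck_on r U (\<lambda>x. inverse (f x))"
  using assms(2)
proof (induction r)
  case 0
  then show ?case using assms(3) by (simp add: continuous_on_inverse)
next
  case (Suc r)
  have IH: "Ck_on r U (\<lambda>x. inverse (f x))" using Suc Ck_on_SucD by blast
  show ?case
  proof (rule Ck_on_SucI[OF assms(1)])
    fix x assume "x \<in> U"
    then show "((\<lambda>x. inverse (f x)) has_derivative
        (\<lambda>v. (- 1) * ((inverse (f x) * frechet_derivative f (at x) v) * inverse (f x)))) (at x)"
      using Deriv.has_derivative_inverse[OF assms(3) Ck_on_Suc_has_derivative[OF Suc.prems]] by fastforce
  next
    fix v
    show "Ck_on r U (\<lambda>x. (- 1) * ((inverse (f x) * frechet_derivative f (at x) v) * inverse (f x)))"
      using Suc.prems IH by (intro Ck_on_mult Ck_on_const assms(1)) auto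
  qed
qed

lemma Ck_on_divide:
  fixes f g :: "'a::euclidean_space \<Rightarrow> real"
  assumes "open U" "Ck_on r U f" "Ck_on r U g" "\<And>x. x \<in> U \<Longrightarrow> g x \<noteq> 0"
  shows "Ck_on r U (\<lambda>x. f x / g x)"
  unfolding divide_inverse by (intro Ck_on_mult Ck_on_inverse assms)

lemma Ck_on_vec:
  fixes f :: "'k::finite \<Rightarrow> 'a::euclidean_space \<Rightarrow> real"
  assumes "open U" "\<And>i. Ck_on r U (f i)"
  shows "Ck_on r U (\<lambda>x. \<chi> i. f i x)"
proof -
  have "(\<lambda>x. \<chi> i. f i x) = (\<lambda>x. \<Sum>i\<in>UNIV. f i x *\<^sub>R axis i 1)"
    by (auto simp: vec_eq_iff axis_def if_distrib cong: if_cong)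
  then show ?thesis
    using assms by (auto intro!: Ck_on_sum Ck_on_scaleR Ck_on_const)
qed

lemma smooth_map_on_open_subset:
  assumes "open U" "A \<subseteq> U" "\<And>r. Ck_on r U f"
  shows "smooth_map_on A f"
  unfolding smooth_map_on_def using assms by blast

section \<open>Power series in several variables\<close>

definition monom_at :: "real ^ 'k \<Rightarrow> ('k::finite \<Rightarrow> nat) \<Rightarrow> real" where
  "monom_at h \<beta> = (\<Prod>i\<in>UNIV. h $ i ^ \<beta> i)"

lemma monom_at_add: "monom_at h (\<lambda>i. \<beta> i + \<gamma> i) = monom_at h \<beta> * monom_at h \<gamma>"
  by (simp add: monom_at_def power_add prod.distrib)

lemma monom_at_vec_pos: "0 < r \<Longrightarrow> 0 < monom_at (vec r) \<beta>"
  by (simp add: monom_at_def prod_pos)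

lemma abs_monom_at_le:
  assumes "\<And>i. \<bar>h $ i\<bar> \<le> r"
  shows "\<bar>monom_at h \<beta>\<bar> \<le> monom_at (vec r) \<beta>"
  unfolding monom_at_def abs_prod power_abs by (auto intro!: prod_mono power_mono assms)

text \<open>\<open>K\<close> bounds the weighted l1-norm of the coefficients on the closed polydisc
  of radius \<open>r\<close>, the norm in which these series form a Banach algebra. As a predicate
  on the sum function it lets closure properties be stated without naming coefficients.\<close>

definition power_series_bounded :: "real \<Rightarrow> real \<Rightarrow> (real ^ 'k::finite \<Rightarrow> 'w::banach) \<Rightarrow> bool" where
  "power_series_bounded r K f \<longleftrightarrow>
     (\<exists>c S. S \<le> K \<and> ((\<lambda>\<beta>. norm (c \<beta>) * monom_at (vec r) \<beta>) has_sum S) UNIV \<and>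
        (\<forall>h. (\<forall>i. \<bar>h $ i\<bar> \<le> r) \<longrightarrow> ((\<lambda>\<beta>. monom_at h \<beta> *\<^sub>R c \<beta>) has_sum f h) UNIV))"

lemma has_sum_norm_le:
  fixes f :: "'a \<Rightarrow> 'b::banach"
  assumes "(g has_sum S) A" "\<And>x. x \<in> A \<Longrightarrow> norm (f x) \<le> g x"
  obtains T where "((\<lambda>x. norm (f x)) has_sum T) A" "T \<le> S"
proof -
  have g: "norm (g x) = g x" if "x \<in> A" for x
    using order.trans[OF norm_ge_zero assms(2)[OF that]] by simp
  have "(\<lambda>x. norm (g x)) summable_on A"
    using has_sum_imp_summable[OF assms(1)] g by (subst summable_on_cong[where g=g]) auto
  then have "(\<lambda>x. norm (f x)) summable_on A"
    by (rule Infinite_Sum.abs_summable_on_comparison_test) (use assms(2) g in auto)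
  then obtain T where T: "((\<lambda>x. norm (f x)) has_sum T) A"
    using summable_on_def by blast
  show ?thesis using that[OF T] has_sum_mono[OF T assms(1)] assms(2) by blast
qed

lemma abs_has_sum_norm_le:
  fixes f :: "'a \<Rightarrow> 'b::banach"
  assumes "(g has_sum S) A" "\<And>x. x \<in> A \<Longrightarrow> norm (f x) \<le> g x"
  shows "f summable_on A" "(f has_sum a) A \<Longrightarrow> norm a \<le> S"
proof -
  obtain T where T: "((\<lambda>x. norm (f x)) has_sum T) A" "T \<le> S"
    by (rule has_sum_norm_le[OF assms])
  show "f summable_on A"
    using T(1) abs_summable_summable has_sum_imp_summable by blast
  show "norm a \<le> S" if "(f has_sum a) A"
    using norm_has_sum_bound[OF T(1) that] T(2) by simp
qed

lemma power_series_bounded_norm_le: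
  assumes "power_series_bounded r K f" "\<And>i. \<bar>h $ i\<bar> \<le> r"
  shows "norm (f h) \<le> K"
proof -
  from assms(1) obtain S c where c: "S \<le> K" "((\<lambda>\<beta>. norm (c \<beta>) * monom_at (vec r) \<beta>) has_sum S) UNIV"
    "\<forall>h. (\<forall>i. \<bar>h $ i\<bar> \<le> r) \<longrightarrow> ((\<lambda>\<beta>. monom_at h \<beta> *\<^sub>R c \<beta>) has_sum f h) UNIV"
    unfolding power_series_bounded_def by blast
  have "norm (f h) \<le> S"
    by (rule abs_has_sum_norm_le(2)[OF c(2) _ c(3)[rule_format, OF assms(2)]])
       (use abs_monom_at_le[of h r, OF assms(2)] in \<open>simp add: mult.commute mult_left_mono\<close>)
  with c(1) show ?thesis by simp
qed

text \<open>Terms with arbitrary index set are collected according to their monomial. Every closure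
  property below then only needs a convenient index set.\<close>

lemma power_series_boundedI:
  fixes a :: "'j \<Rightarrow> 'w::banach" and e :: "'j \<Rightarrow> 'k::finite \<Rightarrow> nat"
  assumes "0 < r" "S \<le> K"
    and S: "((\<lambda>j. norm (a j) * monom_at (vec r) (e j)) has_sum S) J"
    and f: "\<And>h. (\<And>i. \<bar>h $ i\<bar> \<le> r) \<Longrightarrow> ((\<lambda>j. monom_at h (e j) *\<^sub>R a j) has_sum f h) J"
  shows "power_series_bounded r K f"
proof -
  define F where "F \<beta> = {j \<in> J. e j = \<beta>}" for \<beta>
  define c where "c \<beta> = infsum a (F \<beta>)" for \<beta>
  \<comment> \<open>\<open>J\<close> is the disjoint union of the fibres of \<open>e\<close>, so
    sums over \<open>J\<close> become iterated sums, first over a fibre and then over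
    multi-indices.\<close>
  have bij: "bij_betw snd (Sigma UNIV F) J"
    by (rule bij_betwI[of _ _ _ "\<lambda>j. (e j, j)"]) (auto simp: F_def)
  have S': "((\<lambda>(\<beta>, j). norm (a j) * monom_at (vec r) \<beta>) has_sum S) (Sigma UNIV F)"
    using S has_sum_reindex_bij_betw[OF bij, of "\<lambda>j. norm (a j) * monom_at (vec r) (e j)" S]
    by (subst has_sum_cong[where g="\<lambda>x. norm (a (snd x)) * monom_at (vec r) (e (snd x))"]) (auto simp: F_def)
  have sumF: "(\<lambda>j. norm (a j) * monom_at (vec r) \<beta>) summable_on F \<beta>" for \<beta>
    using summable_on_SigmaD1[OF has_sum_imp_summable[OF S'], of \<beta>] by simp
  define G where "G \<beta> = infsum (\<lambda>j. norm (a j) * monom_at (vec r) \<beta>) (F \<beta>)" for \<beta>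
  have hG: "((\<lambda>j. norm (a j) * monom_at (vec r) \<beta>) has_sum G \<beta>) (F \<beta>)" for \<beta>
    unfolding G_def using sumF by simp
  have G: "(G has_sum S) UNIV"
    by (rule has_sum_SigmaD[OF S']) (use hG in auto)
  have "(\<lambda>j. norm (a j)) summable_on F \<beta>" for \<beta>
    using sumF[of \<beta>] less_imp_neq[OF monom_at_vec_pos[OF assms(1), of \<beta>]]
    by (metis summable_on_cmult_left')
  then have hc: "(a has_sum c \<beta>) (F \<beta>)" for \<beta>
    unfolding c_def by (rule has_sum_infsum[OF Infinite_Sum.abs_summable_summable])
  \<comment> \<open>Triangle inequality within one fibre: collecting terms cannot increase the
    weighted norm.\<close>
  have cG: "norm (c \<beta>) * monom_at (vec r) \<beta> \<le> G \<beta>" for \<beta>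
  proof -
    have "((\<lambda>j. monom_at (vec r) \<beta> *\<^sub>R a j) has_sum monom_at (vec r) \<beta> *\<^sub>R c \<beta>) (F \<beta>)"
      using hc by (rule has_sum_scaleR)
    from abs_has_sum_norm_le(2)[OF hG _ this] show ?thesis
      using monom_at_vec_pos[OF assms(1), of \<beta>] by (simp add: mult.commute)
  qed
  have "norm (norm (c \<beta>) * monom_at (vec r) \<beta>) \<le> G \<beta>" for \<beta>
    using cG[of \<beta>] monom_at_vec_pos[OF assms(1), of \<beta>] by (simp add: abs_mult)
  then obtain T where "((\<lambda>\<beta>. norm (norm (c \<beta>) * monom_at (vec r) \<beta>)) has_sum T) UNIV" "T \<le> S"
    by (rule has_sum_norm_le[OF G])
  moreover have "norm (norm (c \<beta>) * monom_at (vec r) \<beta>) = norm (c \<beta>) * monom_at (vec r) \<beta>" for \<beta>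
    using monom_at_vec_pos[OF assms(1), of \<beta>] by (simp add: abs_mult)
  ultimately have T: "((\<lambda>\<beta>. norm (c \<beta>) * monom_at (vec r) \<beta>) has_sum T) UNIV" "T \<le> S"
    by (auto simp only:)
  have "((\<lambda>\<beta>. monom_at h \<beta> *\<^sub>R c \<beta>) has_sum f h) UNIV" if h: "\<And>i. \<bar>h $ i\<bar> \<le> r" for h
  proof -
    have "((\<lambda>(\<beta>, j). monom_at h \<beta> *\<^sub>R a j) has_sum f h) (Sigma UNIV F)"
      using f[OF h] has_sum_reindex_bij_betw[OF bij, of "\<lambda>j. monom_at h (e j) *\<^sub>R a j" "f h"]
      by (subst has_sum_cong[where g="\<lambda>x. monom_at h (e (snd x)) *\<^sub>R a (snd x)"]) (auto simp: F_def)
    then show ?thesis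
      by (rule has_sum_SigmaD) (use hc in \<open>auto intro: has_sum_scaleR\<close>)
  qed
  with T assms(2) show ?thesis
    unfolding power_series_bounded_def by (intro exI[of _ c] exI[of _ T]) auto
qed

section \<open>Closure properties of bounded power series\<close>

lemma power_series_bounded_mono:
  assumes "power_series_bounded r K f" "K \<le> K'"
  shows "power_series_bounded r K' f"
proof -
  from assms(1) obtain S c where "S \<le> K" "((\<lambda>\<beta>. norm (c \<beta>) * monom_at (vec r) \<beta>) has_sum S) UNIV"
    "\<forall>h. (\<forall>i. \<bar>h $ i\<bar> \<le> r) \<longrightarrow> ((\<lambda>\<beta>. monom_at h \<beta> *\<^sub>R c \<beta>) has_sum f h) UNIV"
    unfolding power_series_bounded_def by blast
  with assms(2) show ?thesis
    unfolding power_series_bounded_def by (intro exI[of _ c] exI[of _ S]) auto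
qed

lemma power_series_bounded_zero:
  assumes "0 \<le> K"
  shows "power_series_bounded r K (\<lambda>h. 0)"
  unfolding power_series_bounded_def
  by (rule exI[of _ "\<lambda>_. 0"], rule exI[of _ 0]) (use assms in simp)

text \<open>Only the unit multi-indices \<open>e i\<close> occur. The bound is proportional to
  \<open>r\<close>, so a linear seed becomes as small as desired on a small polydisc.\<close>

lemma power_series_bounded_linear:
  fixes L :: "real ^ 'k::finite \<Rightarrow> 'w::banach"
  assumes "0 < r" "linear L"
  shows "power_series_bounded r (r * (\<Sum>i\<in>UNIV. norm (L (axis i 1)))) L"
proof -
  define e :: "'k \<Rightarrow> 'k \<Rightarrow> nat" where "e i = (\<lambda>j. if j = i then 1 else 0)" for i
  have mon: "monom_at h (e i) = h $ i" for h i
  proof -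
    have "monom_at h (e i) = (\<Prod>j\<in>UNIV. if j = i then h $ j else 1)"
      unfolding monom_at_def e_def by (intro prod.cong) auto
    then show ?thesis by simp
  qed
  have "L h = (\<Sum>i\<in>UNIV. h $ i *\<^sub>R L (axis i 1))" for h
  proof -
    have "h = (\<Sum>i\<in>UNIV. h $ i *\<^sub>R axis i 1)"
      by (auto simp: vec_eq_iff axis_def if_distrib cong: if_cong)
    then have "L h = L (\<Sum>i\<in>UNIV. h $ i *\<^sub>R axis i 1)" by simp
    then show ?thesis by (simp add: linear_sum[OF assms(2)] linear_cmul[OF assms(2)])
  qed
  then have "((\<lambda>i. monom_at h (e i) *\<^sub>R L (axis i 1)) has_sum L h) UNIV" for h
    unfolding mon by (intro has_sum_finiteI[OF finite])
  moreover have "((\<lambda>i. norm (L (axis i 1)) * monom_at (vec r) (e i)) has_sum r * (\<Sum>i\<in>UNIV. norm (L (axis i 1)))) UNIV"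
    by (intro has_sum_finiteI) (simp_all add: mon sum_distrib_left mult.commute)
  ultimately show ?thesis
    by (intro power_series_boundedI[OF assms(1) order.refl])
qed

lemma power_series_bounded_add:
  assumes "power_series_bounded r K f" "power_series_bounded r K' g" "0 < r"
  shows "power_series_bounded r (K + K') (\<lambda>h. f h + g h)"
proof -
  from assms(1) obtain S c where c: "S \<le> K" "((\<lambda>\<beta>. norm (c \<beta>) * monom_at (vec r) \<beta>) has_sum S) UNIV"
    "\<forall>h. (\<forall>i. \<bar>h $ i\<bar> \<le> r) \<longrightarrow> ((\<lambda>\<beta>. monom_at h \<beta> *\<^sub>R c \<beta>) has_sum f h) UNIV"
    unfolding power_series_bounded_def by blast
  from assms(2) obtain T d where d: "T \<le> K'" "((\<lambda>\<beta>. norm (d \<beta>) * monom_at (vec r) \<beta>) has_sum T) UNIV"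
    "\<forall>h. (\<forall>i. \<bar>h $ i\<bar> \<le> r) \<longrightarrow> ((\<lambda>\<beta>. monom_at h \<beta> *\<^sub>R d \<beta>) has_sum g h) UNIV"
    unfolding power_series_bounded_def by blast
  define A where "A = (\<lambda>\<beta>. norm (c \<beta>) * monom_at (vec r) \<beta> + norm (d \<beta>) * monom_at (vec r) \<beta>)"
  have m: "0 < monom_at (vec r) \<beta>" for \<beta> :: "'a \<Rightarrow> nat" by (rule monom_at_vec_pos[OF assms(3)])
  have "(A has_sum S + T) UNIV" unfolding A_def by (rule has_sum_add[OF c(2) d(2)])
  moreover have "norm (monom_at (vec r) \<beta> *\<^sub>R (c \<beta> + d \<beta>)) \<le> A \<beta>" for \<beta>
    using mult_left_mono[OF norm_triangle_ineq less_imp_le[OF m[of \<beta>]], of "c \<beta>" "d \<beta>"] m[of \<beta>]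
    by (simp add: A_def ring_distribs mult.commute del: scaleR_add_right)
  ultimately obtain R where R: "((\<lambda>\<beta>. norm (monom_at (vec r) \<beta> *\<^sub>R (c \<beta> + d \<beta>))) has_sum R) UNIV" "R \<le> S + T"
    by (rule has_sum_norm_le[where g=A and f="\<lambda>\<beta>. monom_at (vec r) \<beta> *\<^sub>R (c \<beta> + d \<beta>)"])
  show ?thesis unfolding power_series_bounded_def
  proof (intro exI conjI allI impI)
    show "((\<lambda>\<beta>. norm (c \<beta> + d \<beta>) * monom_at (vec r) \<beta>) has_sum R) UNIV"
      using R(1) m by (simp add: mult.commute less_imp_le)
    show "R \<le> K + K'" using R c d by simp
    show "((\<lambda>\<beta>. monom_at h \<beta> *\<^sub>R (c \<beta> + d \<beta>)) has_sum f h + g h) UNIV" if "\<forall>i. \<bar>h $ i\<bar> \<le> r" for h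
      unfolding scaleR_add_right using that c(3) d(3) by (intro has_sum_add) auto
  qed
qed

lemma has_sum_times_real:
  fixes f :: "'a \<Rightarrow> real" and g :: "'b \<Rightarrow> real"
  assumes "(f has_sum S) A" "(g has_sum T) B" "\<And>x. x \<in> A \<Longrightarrow> 0 \<le> f x" "\<And>y. y \<in> B \<Longrightarrow> 0 \<le> g y"
  shows "((\<lambda>(x, y). f x * g y) has_sum S * T) (A \<times> B)"
proof (rule has_sum_SigmaI)
  show 1: "((\<lambda>y. case (x, y) of (x, y) \<Rightarrow> f x * g y) has_sum f x * T) B" for x
    using has_sum_cmult_right[OF assms(2)] by simp
  show 2: "((\<lambda>x. f x * T) has_sum S * T) A"
    using has_sum_cmult_left[OF assms(1)] by simp
  show "(\<lambda>(x, y). f x * g y) summable_on A \<times> B"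
    by (rule summable_on_SigmaI[OF 1]) (use 2 assms(3,4) has_sum_imp_summable in auto)
qed


text \<open>The Cauchy product, indexed by pairs of multi-indices whose exponents add; the norm is
  submultiplicative up to the constant \<open>C\<close> of the bilinear map.\<close>

lemma power_series_bounded_bilinear:
  fixes f :: "real ^ 'k::finite \<Rightarrow> 'a::banach" and g :: "real ^ 'k \<Rightarrow> 'b::banach"
    and B :: "'a \<Rightarrow> 'b \<Rightarrow> 'c::banach"
  assumes "bounded_bilinear B" "\<And>x y. norm (B x y) \<le> norm x * norm y * C" "0 \<le> C"
    and "0 < r" "power_series_bounded r K f" "power_series_bounded r K' g"
  shows "power_series_bounded r (K * K' * C) (\<lambda>h. B (f h) (g h))"
proof -
  interpret bounded_bilinear B by fact
  from assms(5) obtain S c where c: "S \<le> K" "((\<lambda>\<beta>. norm (c \<beta>) * monom_at (vec r) \<beta>) has_sum S) UNIV"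
    "\<forall>h. (\<forall>i. \<bar>h $ i\<bar> \<le> r) \<longrightarrow> ((\<lambda>\<beta>. monom_at h \<beta> *\<^sub>R c \<beta>) has_sum f h) UNIV"
    unfolding power_series_bounded_def by blast
  from assms(6) obtain T d where d: "T \<le> K'" "((\<lambda>\<beta>. norm (d \<beta>) * monom_at (vec r) \<beta>) has_sum T) UNIV"
    "\<forall>h. (\<forall>i. \<bar>h $ i\<bar> \<le> r) \<longrightarrow> ((\<lambda>\<beta>. monom_at h \<beta> *\<^sub>R d \<beta>) has_sum g h) UNIV"
    unfolding power_series_bounded_def by blast
  have m: "0 < monom_at (vec r) \<beta>" for \<beta> :: "'k \<Rightarrow> nat" by (rule monom_at_vec_pos[OF assms(4)])
  have "0 \<le> S" "0 \<le> T"
    using has_sum_nonneg[OF c(2)] has_sum_nonneg[OF d(2)] m by (simp_all add: less_imp_le)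
  then have STK: "S * T * C \<le> K * K' * C"
    using c(1) d(1) assms(3) by (intro mult_right_mono mult_mono) auto
  define A where "A = (\<lambda>(\<beta>, \<gamma>). (norm (c \<beta>) * monom_at (vec r) \<beta>) * (norm (d \<gamma>) * monom_at (vec r) \<gamma>))"
  define a where "a = (\<lambda>(\<beta>, \<gamma>). B (c \<beta>) (d \<gamma>))"
  define e :: "('k \<Rightarrow> nat) \<times> ('k \<Rightarrow> nat) \<Rightarrow> 'k \<Rightarrow> nat" where "e = (\<lambda>(\<beta>, \<gamma>) i. \<beta> i + \<gamma> i)"
  have "(A has_sum S * T) (UNIV \<times> UNIV)"
    unfolding A_def using m by (intro has_sum_times_real c d) (simp_all add: less_imp_le)
  then have A: "((\<lambda>x. A x * C) has_sum S * T * C) UNIV"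
    by (intro has_sum_cmult_left) simp
  have le: "norm (a x) * monom_at (vec r) (e x) \<le> A x * C" for x
  proof -
    obtain \<beta> \<gamma> where x: "x = (\<beta>, \<gamma>)" by (cases x)
    have "norm (a x) * monom_at (vec r) (e x) \<le> (norm (c \<beta>) * norm (d \<gamma>) * C) * (monom_at (vec r) \<beta> * monom_at (vec r) \<gamma>)"
      unfolding x a_def e_def using assms(2)[of "c \<beta>" "d \<gamma>"] m[of \<beta>] m[of \<gamma>]
      by (simp add: monom_at_add mult_right_mono)
    then show ?thesis by (simp add: x A_def mult_ac)
  qed
  have "norm (norm (a x) * monom_at (vec r) (e x)) \<le> A x * C" for x
    using le[of x] m[of "e x"] by (simp add: abs_mult)
  then obtain R where "((\<lambda>x. norm (norm (a x) * monom_at (vec r) (e x))) has_sum R) UNIV" "R \<le> S * T * C"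
    by (rule has_sum_norm_le[OF A])
  moreover have "norm (norm (a x) * monom_at (vec r) (e x)) = norm (a x) * monom_at (vec r) (e x)" for x
    using m[of "e x"] by (simp add: abs_mult)
  ultimately have R: "((\<lambda>x. norm (a x) * monom_at (vec r) (e x)) has_sum R) UNIV" "R \<le> S * T * C"
    by (simp_all only:)
  show ?thesis
  proof (rule power_series_boundedI[OF assms(4) _ R(1)])
    show "R \<le> K * K' * C" using R(2) STK by simp
  next
    fix h :: "real ^ 'k" assume h: "\<And>i. \<bar>h $ i\<bar> \<le> r"
    have 1: "((\<lambda>\<gamma>. B (monom_at h \<beta> *\<^sub>R c \<beta>) (monom_at h \<gamma> *\<^sub>R d \<gamma>)) has_sum B (monom_at h \<beta> *\<^sub>R c \<beta>) (g h)) UNIV" for \<beta>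
      by (rule has_sum_bounded_linear[OF bounded_linear_right]) (use d(3) h in auto)
    have 2: "((\<lambda>\<beta>. B (monom_at h \<beta> *\<^sub>R c \<beta>) (g h)) has_sum B (f h) (g h)) UNIV"
      by (rule has_sum_bounded_linear[OF bounded_linear_left]) (use c(3) h in auto)
    have nle: "norm (monom_at h (e x) *\<^sub>R a x) \<le> A x * C" for x
    proof -
      have "norm (monom_at h (e x) *\<^sub>R a x) \<le> norm (a x) * monom_at (vec r) (e x)"
        using abs_monom_at_le[of h r "e x", OF h] by (simp add: mult.commute mult_left_mono)
      with le[of x] show ?thesis by simp
    qed
    have eq: "monom_at h (e (\<beta>, \<gamma>)) *\<^sub>R a (\<beta>, \<gamma>) = B (monom_at h \<beta> *\<^sub>R c \<beta>) (monom_at h \<gamma> *\<^sub>R d \<gamma>)" for \<beta> \<gamma>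
      by (simp add: e_def a_def monom_at_add scaleR_left scaleR_right)
    have "(\<lambda>x. monom_at h (e x) *\<^sub>R a x) summable_on UNIV \<times> UNIV"
      using abs_has_sum_norm_le(1)[OF A nle] by simp
    then have "((\<lambda>x. monom_at h (e x) *\<^sub>R a x) has_sum B (f h) (g h)) (UNIV \<times> UNIV)"
      by (intro has_sum_SigmaI[where g="\<lambda>\<beta>. B (monom_at h \<beta> *\<^sub>R c \<beta>) (g h)"]) (use 1 2 eq in auto)
    then show "((\<lambda>x. monom_at h (e x) *\<^sub>R a x) has_sum B (f h) (g h)) UNIV" by simp
  qed
qed

text \<open>Completeness of the algebra: summable bounds make the double family over pairs
  \<open>(n, \<beta>)\<close> absolutely summable, so the order of summation may be
  exchanged.\<close>

lemma power_series_bounded_infsum: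
  fixes f :: "nat \<Rightarrow> real ^ 'k::finite \<Rightarrow> 'w::banach"
  assumes "0 < r" "\<And>n. power_series_bounded r (K n) (f n)" "(K has_sum M) UNIV"
    and F: "\<And>h. (\<And>i. \<bar>h $ i\<bar> \<le> r) \<Longrightarrow> ((\<lambda>n. f n h) has_sum F h) UNIV"
  shows "power_series_bounded r M F"
proof -
  have "\<forall>n. \<exists>c S. S \<le> K n \<and> ((\<lambda>\<beta>. norm (c \<beta>) * monom_at (vec r) \<beta>) has_sum S) UNIV \<and>
      (\<forall>h. (\<forall>i. \<bar>h $ i\<bar> \<le> r) \<longrightarrow> ((\<lambda>\<beta>. monom_at h \<beta> *\<^sub>R c \<beta>) has_sum f n h) UNIV)"
    using assms(2) unfolding power_series_bounded_def by simp
  from choice[OF this] obtain c where "\<forall>n. \<exists>S. S \<le> K n \<and> ((\<lambda>\<beta>. norm (c n \<beta>) * monom_at (vec r) \<beta>) has_sum S) UNIV \<and>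
      (\<forall>h. (\<forall>i. \<bar>h $ i\<bar> \<le> r) \<longrightarrow> ((\<lambda>\<beta>. monom_at h \<beta> *\<^sub>R c n \<beta>) has_sum f n h) UNIV)" ..
  from choice[OF this] obtain S where cS': "\<forall>n. S n \<le> K n \<and> ((\<lambda>\<beta>. norm (c n \<beta>) * monom_at (vec r) \<beta>) has_sum S n) UNIV \<and>
      (\<forall>h. (\<forall>i. \<bar>h $ i\<bar> \<le> r) \<longrightarrow> ((\<lambda>\<beta>. monom_at h \<beta> *\<^sub>R c n \<beta>) has_sum f n h) UNIV)" ..
  have SK: "S n \<le> K n" and cS: "((\<lambda>\<beta>. norm (c n \<beta>) * monom_at (vec r) \<beta>) has_sum S n) UNIV"
    and cf: "\<forall>h. (\<forall>i. \<bar>h $ i\<bar> \<le> r) \<longrightarrow> ((\<lambda>\<beta>. monom_at h \<beta> *\<^sub>R c n \<beta>) has_sum f n h) UNIV" for n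
    using cS' by blast+
  have m: "0 < monom_at (vec r) \<beta>" for \<beta> :: "'k \<Rightarrow> nat" by (rule monom_at_vec_pos[OF assms(1)])
  have S0: "0 \<le> S n" for n
    using has_sum_nonneg[OF cS] m by (simp add: less_imp_le)
  have "norm (S n) \<le> K n" for n using S0 SK by simp
  then obtain T where "((\<lambda>n. norm (S n)) has_sum T) UNIV" "T \<le> M"
    by (rule has_sum_norm_le[OF assms(3)])
  then have T: "(S has_sum T) UNIV" "T \<le> M" using S0 by simp_all
  define a where "a = (\<lambda>(n, \<beta>). c n \<beta>)"
  have sum: "((\<lambda>x. norm (a x) * monom_at (vec r) (snd x)) has_sum T) (UNIV \<times> UNIV)"
  proof (rule has_sum_SigmaI)
    show 1: "((\<lambda>\<beta>. norm (a (n, \<beta>)) * monom_at (vec r) (snd (n, \<beta>))) has_sum S n) UNIV" for n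
      using cS by (simp add: a_def)
    show "(\<lambda>x. norm (a x) * monom_at (vec r) (snd x)) summable_on UNIV \<times> UNIV"
      by (rule summable_on_SigmaI[OF 1]) (use T(1) m in \<open>auto simp: less_imp_le has_sum_imp_summable\<close>)
  qed (use T in auto)
  show ?thesis
  proof (rule power_series_boundedI[OF assms(1) T(2) sum])
    fix h :: "real ^ 'k" assume h: "\<And>i. \<bar>h $ i\<bar> \<le> r"
    show "((\<lambda>x. monom_at h (snd x) *\<^sub>R a x) has_sum F h) (UNIV \<times> UNIV)"
    proof (rule has_sum_SigmaI)
      show "((\<lambda>\<beta>. monom_at h (snd (n, \<beta>)) *\<^sub>R a (n, \<beta>)) has_sum f n h) UNIV" for n
        using cf h by (simp add: a_def)
      show "((\<lambda>n. f n h) has_sum F h) UNIV" by (rule F[OF h])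
      have "norm (monom_at h (snd x) *\<^sub>R a x) \<le> norm (a x) * monom_at (vec r) (snd x)" for x
        using abs_monom_at_le[of h r "snd x", OF h] by (simp add: mult.commute mult_left_mono)
      then show "(\<lambda>x. monom_at h (snd x) *\<^sub>R a x) summable_on UNIV \<times> UNIV"
        by (intro abs_has_sum_norm_le(1)[OF sum])
    qed
  qed
qed

text \<open>A quadratic fixed-point equation is solved by Picard iteration in the Banach algebra of
  absolutely convergent power series: if \<open>2 C \<delta> \<le> 1 / 2\<close>, the iteration stays in the ball of radius
  \<open>\<delta>\<close> and contracts by the factor \<open>1 / 2\<close>.\<close>

theorem power_series_quadratic_fixpoint:
  fixes B :: "'w::banach \<Rightarrow> 'w \<Rightarrow> 'w" and \<iota> :: "real ^ 'k::finite \<Rightarrow> 'w"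
  assumes "bounded_bilinear B" "linear \<iota>" "0 < \<epsilon>"
  obtains r Z where "0 < r" "power_series_bounded r \<epsilon> Z"
    "\<forall>h. (\<forall>i. \<bar>h $ i\<bar> \<le> r) \<longrightarrow> Z h = \<iota> h + B (Z h) (Z h)"
proof -
  interpret bounded_bilinear B by fact
  obtain C where C: "0 < C" "\<And>x y. norm (B x y) \<le> norm x * norm y * C"
    using pos_bounded by blast
  define \<delta> where "\<delta> = min \<epsilon> (1 / (4 * C))"
  have \<delta>: "0 < \<delta>" "\<delta> \<le> \<epsilon>" "\<delta> * C \<le> 1 / 4"
  proof -
    show "0 < \<delta>" "\<delta> \<le> \<epsilon>" using assms(3) C(1) by (auto simp: \<delta>_def)
    have "\<delta> \<le> 1 / (4 * C)" by (simp add: \<delta>_def)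
    then show "\<delta> * C \<le> 1 / 4" using C(1) by (simp add: field_simps)
  qed
  define L where "L = (\<Sum>i\<in>UNIV. norm (\<iota> (axis i 1)))"
  have L: "0 \<le> L" by (simp add: L_def sum_nonneg)
  \<comment> \<open>The radius leaves half of the ball to the linear seed; the quadratic part then
    uses at most a further quarter. The summand 1 guards against \<open>L = 0\<close>.\<close>
  define r where "r = \<delta> / (2 * (L + 1))"
  have r: "0 < r" using \<delta> L by (simp add: r_def)
  have "r * L \<le> \<delta> / 2" using \<delta> L by (simp add: r_def field_simps)
  then have \<iota>: "power_series_bounded r (\<delta> / 2) \<iota>"
    using power_series_bounded_mono[OF power_series_bounded_linear[OF r assms(2)]] unfolding L_def by blast
  define Y where "Y = rec_nat (\<lambda>h. 0) (\<lambda>_ Y h. \<iota> h + B (Y h) (Y h))"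
  have Y0: "Y 0 = (\<lambda>h. 0)" and YS: "Y (Suc n) = (\<lambda>h. \<iota> h + B (Y n h) (Y n h))" for n
    by (simp_all add: Y_def)
  note bil = power_series_bounded_bilinear[OF assms(1) C(2) less_imp_le[OF C(1)] r]
  have Y: "power_series_bounded r \<delta> (Y n)" for n
  proof (induction n)
    case 0
    then show ?case unfolding Y0 by (rule power_series_bounded_zero) (use \<delta> in simp)
  next
    case (Suc n)
    have "\<delta> * (\<delta> * C) \<le> \<delta> * (1 / 4)" using \<delta> by (intro mult_left_mono) auto
    then have "\<delta> / 2 + \<delta> * \<delta> * C \<le> \<delta>" using \<delta>(1) unfolding mult.assoc by linarith
    then show ?case unfolding YS
      by (rule power_series_bounded_mono[OF power_series_bounded_add[OF \<iota> bil[OF Suc Suc] r]])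
  qed
  define D where "D n = (\<lambda>h. Y (Suc n) h - Y n h)" for n
  \<comment> \<open>The difference of two squares under \<open>B\<close> splits bilinearly, and each
    of the two parts contracts by the factor 1/4.\<close>
  have DS: "D (Suc n) = (\<lambda>h. B (D n h) (Y (Suc n) h) + B (Y n h) (D n h))" for n
    by (simp add: D_def YS[of "Suc n"] YS[of n] diff_left diff_right fun_eq_iff)
  have D: "power_series_bounded r (\<delta> * (1 / 2) ^ Suc n) (D n)" for n
  proof (induction n)
    case 0
    then show ?case using \<iota> by (simp add: D_def YS Y0 zero_left)
  next
    case (Suc n)
    define d where "d = \<delta> * (1 / 2) ^ Suc n"
    have "0 \<le> d" using \<delta> by (simp add: d_def)
    then have "d * (\<delta> * C) \<le> d * (1 / 4)" using \<delta> by (intro mult_left_mono) auto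
    then have "d * \<delta> * C + \<delta> * d * C \<le> d / 2"
      unfolding mult.assoc mult.left_commute[of \<delta> d C] by linarith
    also have "d / 2 = \<delta> * (1 / 2) ^ Suc (Suc n)" by (simp add: d_def)
    finally show ?case unfolding DS
      by (rule power_series_bounded_mono[OF power_series_bounded_add[OF
            bil[OF Suc.IH[folded d_def] Y] bil[OF Y Suc.IH[folded d_def]] r]])
  qed
  \<comment> \<open>The increments start at \<delta>/2 and halve, so their bounds add up to exactly
    \<delta>: the limit stays in the ball of the iterates.\<close>
  have "(\<lambda>n. \<delta> * ((1 / 2) * (1 / 2) ^ n)) sums (\<delta> * ((1 / 2) * (1 / (1 - 1 / 2))))"
    by (intro sums_mult geometric_sums) simp
  then have "(\<lambda>n. \<delta> * (1 / 2) ^ Suc n) sums \<delta>" by simp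
  then have \<delta>_sum: "((\<lambda>n. \<delta> * (1 / 2) ^ Suc n) has_sum \<delta>) UNIV"
    by (rule sums_nonneg_imp_has_sum_strong) (use \<delta> in auto)
  define Z where "Z h = infsum (\<lambda>n. D n h) UNIV" for h
  have Zsum: "((\<lambda>n. D n h) has_sum Z h) UNIV" if h: "\<And>i. \<bar>h $ i\<bar> \<le> r" for h
    unfolding Z_def
    by (rule has_sum_infsum, rule abs_has_sum_norm_le(1)[OF \<delta>_sum])
       (rule power_series_bounded_norm_le[OF D h])
  have "power_series_bounded r \<delta> Z"
    by (rule power_series_bounded_infsum[OF r D \<delta>_sum Zsum])
  then have "power_series_bounded r \<epsilon> Z" using \<delta>(2) by (rule power_series_bounded_mono)
  moreover have "Z h = \<iota> h + B (Z h) (Z h)" if h: "\<And>i. \<bar>h $ i\<bar> \<le> r" for h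
  proof -
    have "(\<lambda>n. D n h) sums Z h" using Zsum[OF h] by (rule has_sum_imp_sums)
    moreover have "(\<Sum>i<n. D i h) = Y n h" for n
      by (induction n) (simp_all add: D_def Y0)
    ultimately have lim: "(\<lambda>n. Y n h) \<longlonglongrightarrow> Z h" by (simp add: sums_def)
    then have "(\<lambda>n. Y (Suc n) h) \<longlonglongrightarrow> \<iota> h + B (Z h) (Z h)"
      unfolding YS by (intro tendsto_add tendsto_const tendsto)
    with LIMSEQ_Suc[OF lim] show ?thesis using LIMSEQ_unique by blast
  qed
  ultimately show thesis using that[OF r] by blast
qed

text \<open>A Euclidean ball lies in the polydisc of the same radius, and a bounded linear
  functional can be applied coefficientwise. The constant \<open>c0\<close> is absorbed into the
  coefficient at the zero multi-index.\<close>

lemma real_analytic_at_linear_power_series: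
  fixes F :: "real ^ 'k::finite \<Rightarrow> real"
  assumes "0 < r" "power_series_bounded r K Z" "bounded_linear g"
    and F: "\<And>x. x \<in> ball a r \<Longrightarrow> F x = c0 + g (Z (x - a))"
  shows "real_analytic_at F a"
proof -
  interpret bounded_linear g by fact
  from assms(2) obtain c where c:
    "\<forall>h. (\<forall>i. \<bar>h $ i\<bar> \<le> r) \<longrightarrow> ((\<lambda>\<beta>. monom_at h \<beta> *\<^sub>R c \<beta>) has_sum Z h) UNIV"
    unfolding power_series_bounded_def by blast
  define b where "b \<beta> = (if \<beta> = (\<lambda>_. 0) then c0 else 0) + g (c \<beta>)" for \<beta>
  show ?thesis unfolding real_analytic_at_def
  proof (intro exI[of _ b] exI[of _ r] conjI ballI assms(1))
    fix x assume x: "x \<in> ball a r"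
    have "\<bar>(x - a) $ i\<bar> \<le> r" for i
      using component_le_norm_cart[of "x - a" i] x by (simp add: dist_norm norm_minus_commute)
    then have "((\<lambda>\<beta>. monom_at (x - a) \<beta> *\<^sub>R c \<beta>) has_sum Z (x - a)) UNIV" using c by blast
    from has_sum_bounded_linear[OF assms(3) this]
    have 1: "((\<lambda>\<beta>. monom_at (x - a) \<beta> * g (c \<beta>)) has_sum g (Z (x - a))) UNIV"
      by (simp add: scaleR)
    have 2: "((\<lambda>\<beta>. (if \<beta> = (\<lambda>_. 0) then c0 else 0) * monom_at (x - a) \<beta>) has_sum c0) UNIV"
      by (rule has_sum_finite_neutralI[of "{\<lambda>_. 0}"]) (auto simp: monom_at_def)
    have "b \<beta> * (\<Prod>i\<in>UNIV. (x $ i - a $ i) ^ \<beta> i) =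
        (if \<beta> = (\<lambda>_. 0) then c0 else 0) * monom_at (x - a) \<beta> + monom_at (x - a) \<beta> * g (c \<beta>)" for \<beta>
      by (simp add: b_def monom_at_def distrib_right mult.commute)
    then show "((\<lambda>\<beta>. b \<beta> * (\<Prod>i\<in>UNIV. (x $ i - a $ i) ^ \<beta> i)) has_sum F x) UNIV"
      unfolding F[OF x] using has_sum_add[OF 2 1] by (simp only:)
  qed
qed

section \<open>Eigenvectors in the chamber\<close>

text \<open>The Coxeter matrix enters only through the signs of the inner products:
  \<open>obtuse\<close> and the connected graph of strictly obtuse pairs. \<open>dual\<close> and
  \<open>separating\<close> make \<open>n\<close> and \<open>q\<close> dual bases.\<close>

locale simple_system =
  fixes n q :: "'k::finite \<Rightarrow> 'a::euclidean_space"
  assumes norm_n: "norm (n i) = 1"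
    and dual: "n i \<bullet> q j = (if i = j then 1 else 0)"
    and separating: "(\<And>i. n i \<bullet> w = 0) \<Longrightarrow> w = 0"
    and obtuse: "i \<noteq> j \<Longrightarrow> n i \<bullet> n j \<le> 0"
    and connected: "(i, j) \<in> {(a, b). n a \<bullet> n b < 0}\<^sup>*"
    and rank: "2 \<le> CARD('k)"
begin

section \<open>Positivity of the Gram matrix of the dual basis\<close>

lemma dual': "q j \<bullet> n i = (if i = j then 1 else 0)"
  using dual[of i j] by (simp add: inner_commute)

lemma expand_q: "w = (\<Sum>i\<in>UNIV. (n i \<bullet> w) *\<^sub>R q i)"
proof -
  have "w - (\<Sum>i\<in>UNIV. (n i \<bullet> w) *\<^sub>R q i) = 0"
    by (rule separating) (simp add: inner_diff_right inner_sum_right dual if_distrib cong: if_cong)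
  then show ?thesis by simp
qed

lemma expand_inner: "v \<bullet> w = (\<Sum>i\<in>UNIV. (n i \<bullet> v) * (q i \<bullet> w))"
  by (subst expand_q[of v]) (simp add: inner_sum_left)

lemma separating_q:
  assumes "\<And>i. q i \<bullet> w = 0"
  shows "w = 0"
  using expand_inner[of w w] assms by simp

lemma expand_n: "w = (\<Sum>i\<in>UNIV. (q i \<bullet> w) *\<^sub>R n i)"
proof -
  have "w - (\<Sum>i\<in>UNIV. (q i \<bullet> w) *\<^sub>R n i) = 0"
    by (rule separating_q) (simp add: inner_diff_right inner_sum_right dual' if_distrib cong: if_cong)
  then show ?thesis by simp
qed

lemma expand_inner_gram: "v \<bullet> w = (\<Sum>i\<in>UNIV. \<Sum>j\<in>UNIV. (n i \<bullet> v) * (n j \<bullet> w) * (q i \<bullet> q j))"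
proof -
  have "q i \<bullet> w = (\<Sum>j\<in>UNIV. (n j \<bullet> w) * (q i \<bullet> q j))" for i
    using expand_inner[of w "q i"] by (simp add: inner_commute[of w] inner_commute[of _ "q i"])
  then show ?thesis by (simp add: expand_inner[of v w] sum_distrib_left mult.assoc)
qed

text \<open>Split the coordinates of \<open>q i\<close> in the basis \<open>n\<close> by sign,
  \<open>q i = P - N\<close>. Obtuseness gives \<open>N \<bullet> P \<le> 0\<close>, while
  \<open>N \<bullet> q i\<close> is a coefficient of \<open>N\<close> and so nonnegative; hence
  \<open>N \<bullet> N \<le> 0\<close> and \<open>N\<close> vanishes.\<close>

lemma inner_q_nonneg: "0 \<le> q i \<bullet> q j"
proof -
  define b where "b l = q l \<bullet> q i" for l
  define N where "N = (\<Sum>l\<in>UNIV. max 0 (- b l) *\<^sub>R n l)"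
  have qN: "q l \<bullet> N = max 0 (- b l)" for l
    by (simp add: N_def inner_sum_right dual' if_distrib cong: if_cong)
  define P where "P = (\<Sum>l\<in>UNIV. max 0 (b l) *\<^sub>R n l)"
  have "q i = (\<Sum>l\<in>UNIV. b l *\<^sub>R n l)" unfolding b_def by (rule expand_n)
  also have "\<dots> = P - N"
    unfolding P_def N_def sum_subtractf[symmetric] scaleR_diff_left[symmetric]
    by (intro sum.cong) (auto simp: max_def)
  finally have qi: "q i = P - N" .
  have "N \<bullet> P \<le> 0"
    unfolding N_def P_def inner_sum_left inner_sum_right
  proof (intro sum_nonpos)
    fix l l'
    have "(max 0 (- b l) * max 0 (b l')) * (n l \<bullet> n l') \<le> 0"
    proof (cases "l = l'")
      case True
      then show ?thesis by (auto simp: max_def)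
    next
      case False
      then show ?thesis by (intro mult_nonneg_nonpos obtuse) auto
    qed
    then show "max 0 (- b l) *\<^sub>R n l \<bullet> max 0 (b l') *\<^sub>R n l' \<le> 0" by (simp add: mult_ac)
  qed
  moreover have "0 \<le> N \<bullet> q i" using qN[of i] by (simp add: inner_commute)
  ultimately have "N \<bullet> N \<le> 0" by (simp add: qi inner_diff_right)
  then have "N = 0" using inner_ge_zero[of N] by (metis antisym inner_eq_zero_iff)
  then have "max 0 (- b j) = 0" using qN[of j] by simp
  then show ?thesis by (simp add: b_def inner_commute)
qed

text \<open>A zero spreads along the Coxeter graph: if \<open>q a \<bullet> q i = 0\<close>, then
  \<open>n a \<bullet> q i \<ge> 0\<close> is a sum of nonpositive terms, so each term vanishes, in
  particular at the neighbours of \<open>a\<close>. Connectedness would carry the zero to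
  \<open>q i \<bullet> q i\<close>.\<close>

lemma inner_q_pos: "0 < q i \<bullet> q j"
proof -
  have step: "q b \<bullet> q i = 0" if "q a \<bullet> q i = 0" "n a \<bullet> n b < 0" for a b
  proof -
    have "a \<noteq> b" using that(2) inner_ge_zero[of "n a"] by force
    have "n a \<bullet> q i = (\<Sum>l\<in>UNIV. (q l \<bullet> q i) * (n a \<bullet> n l))"
      by (subst expand_n[of "q i"]) (simp add: inner_sum_right)
    moreover have nonpos: "(q l \<bullet> q i) * (n a \<bullet> n l) \<le> 0" for l
      using that(1) by (cases "l = a") (auto intro!: mult_nonneg_nonpos inner_q_nonneg obtuse)
    moreover have "0 \<le> n a \<bullet> q i" by (simp add: dual)
    moreover have "(\<Sum>l\<in>UNIV. (q l \<bullet> q i) * (n a \<bullet> n l)) \<le> 0" by (intro sum_nonpos nonpos)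
    ultimately have "(\<Sum>l\<in>UNIV. (q l \<bullet> q i) * (n a \<bullet> n l)) = 0" by linarith
    then have "(\<Sum>l\<in>UNIV. - ((q l \<bullet> q i) * (n a \<bullet> n l))) = 0" by (simp add: sum_negf)
    then have "(q b \<bullet> q i) * (n a \<bullet> n b) = 0"
      using nonpos by (subst (asm) sum_nonneg_eq_0_iff) simp_all
    then show ?thesis using that(2) by simp
  qed
  have "q i \<bullet> q i = 0" if "q j \<bullet> q i = 0"
    using connected[of j i] that
    by (induction rule: converse_rtrancl_induct) (auto dest: step)
  moreover have "q i \<bullet> q i \<noteq> 0"
    using dual[of i i] by auto
  ultimately have "q j \<bullet> q i \<noteq> 0" by blast
  then show ?thesis using inner_q_nonneg[of i j] by (simp add: inner_commute order.strict_iff_order)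
qed

definition open_chamber :: "'a set" where
  "open_chamber = {p. \<forall>i. 0 < n i \<bullet> p}"

lemma open_open_chamber: "open open_chamber"
proof -
  have "open_chamber = (\<Inter>i. {p. 0 < n i \<bullet> p})" by (auto simp: open_chamber_def)
  then show ?thesis by (simp add: open_INT open_halfspace_gt)
qed

lemma open_chamberD:
  assumes "p \<in> open_chamber"
  shows "0 < n i \<bullet> p" "n i \<bullet> p \<noteq> 0"
proof -
  show "0 < n i \<bullet> p" using assms by (simp add: open_chamber_def)
  then show "n i \<bullet> p \<noteq> 0" by simp
qed

text \<open>The source of strictness in both the uniqueness and the existence of the Perron
  eigenvector: a nonzero point of the closed chamber has strictly positive dual coordinates.\<close>

lemma inner_q_pos_of_nonneg:
  assumes "\<And>i. 0 \<le> n i \<bullet> p" "p \<noteq> 0"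
  shows "0 < q i \<bullet> p"
proof -
  obtain j where j: "n j \<bullet> p \<noteq> 0" using assms(2) separating by blast
  have "p \<bullet> q i = (\<Sum>l\<in>UNIV. (n l \<bullet> p) * (q l \<bullet> q i))" by (rule expand_inner)
  also have "\<dots> > 0"
    by (rule sum_pos2[of _ j]) (use j assms(1) inner_q_pos in \<open>auto simp: less_imp_le order.strict_iff_order\<close>)
  finally show ?thesis by (simp add: inner_commute)
qed

lemma open_chamber_inner_q_pos: "p \<in> open_chamber \<Longrightarrow> 0 < q i \<bullet> p"
  by (rule inner_q_pos_of_nonneg) (auto simp: open_chamber_def less_imp_le)

lemma open_chamber_inner_pos:
  assumes "p \<in> open_chamber" "p' \<in> open_chamber"
  shows "0 < p \<bullet> p'"
  unfolding expand_inner[of p p']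
  by (rule sum_pos) (use assms open_chamber_inner_q_pos in \<open>auto simp: open_chamber_def\<close>)

section \<open>The weighted Gram operator and its Perron eigenvector\<close>

definition weighted_gram :: "real ^ 'k \<Rightarrow> 'a \<Rightarrow> 'a" where
  "weighted_gram x p = (\<Sum>i\<in>UNIV. (x $ i * (n i \<bullet> p)) *\<^sub>R n i)"

lemma weighted_gram_add: "weighted_gram x (p + p') = weighted_gram x p + weighted_gram x p'"
  and weighted_gram_scale: "weighted_gram x (c *\<^sub>R p) = c *\<^sub>R weighted_gram x p"
  and weighted_gram_add_left: "weighted_gram (x + y) p = weighted_gram x p + weighted_gram y p"
  and weighted_gram_scale_left: "weighted_gram (c *\<^sub>R x) p = c *\<^sub>R weighted_gram x p"
  by (simp_all add: weighted_gram_def inner_add_right algebra_simps sum.distrib scaleR_sum_right)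

lemma weighted_gram_inner: "weighted_gram x p \<bullet> w = (\<Sum>i\<in>UNIV. x $ i * (n i \<bullet> p) * (n i \<bullet> w))"
  by (simp add: weighted_gram_def inner_sum_left)

lemma weighted_gram_sym: "weighted_gram x p \<bullet> w = p \<bullet> weighted_gram x w"
  unfolding inner_commute[of p] by (simp add: weighted_gram_inner mult_ac)

lemma weighted_gram_eigen_iff:
  "weighted_gram x p = \<nu> *\<^sub>R p \<longleftrightarrow> (\<forall>i. x $ i * (n i \<bullet> p) = \<nu> * (q i \<bullet> p))"
proof -
  have qT: "q i \<bullet> weighted_gram x p = x $ i * (n i \<bullet> p)" for i
    by (simp add: weighted_gram_def inner_sum_right dual' if_distrib cong: if_cong)
  show ?thesis
  proof
    assume "weighted_gram x p = \<nu> *\<^sub>R p"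
    then show "\<forall>i. x $ i * (n i \<bullet> p) = \<nu> * (q i \<bullet> p)" using qT by (metis inner_scaleR_right)
  next
    assume "\<forall>i. x $ i * (n i \<bullet> p) = \<nu> * (q i \<bullet> p)"
    then have "weighted_gram x p - \<nu> *\<^sub>R p = 0"
      by (intro separating_q) (simp add: inner_diff_right qT)
    then show "weighted_gram x p = \<nu> *\<^sub>R p" by simp
  qed
qed

text \<open>By symmetry of the operator, \<open>\<nu>\<close> and \<open>\<nu>'\<close> agree after
  multiplication by \<open>p \<bullet> p'\<close>, which is positive in the chamber.\<close>

lemma eigenvalue_unique:
  assumes "p \<in> open_chamber" "weighted_gram x p = \<nu> *\<^sub>R p"
    and "p' \<in> open_chamber" "weighted_gram x p' = \<nu>' *\<^sub>R p'"
  shows "\<nu> = \<nu>'"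
  using weighted_gram_sym[of x p p'] open_chamber_inner_pos[OF assms(1,3)] assms(2,4) by simp

text \<open>Subtract from \<open>r\<close> the largest multiple of \<open>p\<close> that leaves the
  difference \<open>w\<close> in the closed chamber. Then \<open>w\<close> lies on some wall
  \<open>j\<close>, and the eigenvalue equation turns \<open>n j \<bullet> w = 0\<close> into
  \<open>q j \<bullet> w = 0\<close>, which is possible only for \<open>w = 0\<close>. Since
  \<open>r\<close> is arbitrary, the eigenvalue is simple.\<close>

lemma eigenvector_unique:
  assumes x: "\<And>i. 0 < x $ i" and p: "p \<in> open_chamber"
    and eig: "weighted_gram x p = \<nu> *\<^sub>R p" "weighted_gram x r = \<nu> *\<^sub>R r"
  obtains c where "r = c *\<^sub>R p"
proof -
  have np: "0 < n i \<bullet> p" for i using p by (simp add: open_chamber_def)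
  define R where "R = (\<lambda>i. (n i \<bullet> r) / (n i \<bullet> p))"
  define t where "t = Min (range R)"
  have t: "t \<le> R i" for i by (simp add: t_def)
  have "t \<in> range R" unfolding t_def by (rule Min_in) auto
  then obtain j where j: "t = R j" by blast
  define w where "w = r - t *\<^sub>R p"
  have "0 \<le> n i \<bullet> w" for i
    using t[of i] np[of i] by (simp add: w_def inner_diff_right R_def pos_le_divide_eq)
  moreover have "n j \<bullet> w = 0"
    using np[of j] by (simp add: w_def inner_diff_right j R_def)
  moreover have "weighted_gram x w = \<nu> *\<^sub>R w"
    using weighted_gram_add[of x w "t *\<^sub>R p"] eig
    by (simp add: w_def weighted_gram_scale algebra_simps)
  then have "x $ j * (n j \<bullet> w) = \<nu> * (q j \<bullet> w)" by (simp add: weighted_gram_eigen_iff)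
  moreover have "\<nu> \<noteq> 0"
  proof
    assume "\<nu> = 0"
    then have "x $ j * (n j \<bullet> p) = 0" using weighted_gram_eigen_iff[THEN iffD1, OF eig(1)] by simp
    then show False using x[of j] np[of j] by simp
  qed
  ultimately have "(\<forall>i. 0 \<le> n i \<bullet> w) \<and> q j \<bullet> w = 0" by simp
  then have "w = 0" using inner_q_pos_of_nonneg[of w j] by fastforce
  then show thesis using that[of t] by (simp add: w_def)
qed

text \<open>Perron--Frobenius by minimising the Rayleigh quotient: making the coordinates of a minimiser
  with respect to the dual basis nonnegative does not change the numerator and does not decrease
  the norm, because the dual basis has positive Gram matrix.\<close>

lemma eigenvector_exists:
  assumes x: "\<And>i. 0 < x $ i"
  obtains p \<nu> where "p \<in> open_chamber" "norm p = 1" "weighted_gram x p = \<nu> *\<^sub>R p"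
proof -
  define f where "f p = weighted_gram x p \<bullet> p" for p
  have f: "f p = (\<Sum>i\<in>UNIV. x $ i * (n i \<bullet> p)\<^sup>2)" for p
    by (simp add: f_def weighted_gram_inner power2_eq_square mult.assoc)
  have f_scale: "f (c *\<^sub>R p) = c\<^sup>2 * f p" for c p
    by (simp add: f_def weighted_gram_scale power2_eq_square)
  have "continuous_on (sphere 0 1) f" unfolding f by (intro continuous_intros)
  moreover have "(sphere 0 1 :: 'a set) \<noteq> {}" by simp
  ultimately obtain p0 where p0: "p0 \<in> sphere 0 1" "\<And>p. p \<in> sphere 0 1 \<Longrightarrow> f p0 \<le> f p"
    using continuous_attains_inf[of "sphere 0 1 :: 'a set" f] by auto
  define \<mu> where "\<mu> = f p0"
  have \<mu>0: "0 \<le> \<mu>" unfolding \<mu>_def f by (intro sum_nonneg) (use x in \<open>simp add: less_imp_le\<close>)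
  have min: "\<mu> * (norm p)\<^sup>2 \<le> f p" for p
  proof (cases "p = 0")
    case True
    then show ?thesis by (simp add: f)
  next
    case False
    have "\<mu> \<le> f ((1 / norm p) *\<^sub>R p)" unfolding \<mu>_def by (rule p0) (use False in simp)
    then show ?thesis using False by (simp add: f_scale field_simps power2_eq_square)
  qed
  define p' where "p' = (\<Sum>i\<in>UNIV. \<bar>n i \<bullet> p0\<bar> *\<^sub>R q i)"
  have np': "n i \<bullet> p' = \<bar>n i \<bullet> p0\<bar>" for i
    by (simp add: p'_def inner_sum_right dual if_distrib cong: if_cong)
  have fp': "f p' = \<mu>" by (simp add: f np' \<mu>_def)
  have "1 = p0 \<bullet> p0" using p0(1) by (simp add: norm_eq_1)
  also have "\<dots> = (\<Sum>i\<in>UNIV. \<Sum>j\<in>UNIV. (n i \<bullet> p0) * (n j \<bullet> p0) * (q i \<bullet> q j))"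
    by (rule expand_inner_gram)
  also have "\<dots> \<le> (\<Sum>i\<in>UNIV. \<Sum>j\<in>UNIV. \<bar>n i \<bullet> p0\<bar> * \<bar>n j \<bullet> p0\<bar> * (q i \<bullet> q j))"
    by (intro sum_mono mult_right_mono inner_q_nonneg) (metis abs_ge_self abs_mult)
  also have "\<dots> = (norm p')\<^sup>2"
    unfolding power2_norm_eq_inner expand_inner_gram[of p' p'] np' ..
  finally have p'1: "1 \<le> (norm p')\<^sup>2" .
  have "\<mu> * 1 \<le> \<mu> * (norm p')\<^sup>2" using p'1 \<mu>0 by (rule mult_left_mono)
  then have fp'': "f p' = \<mu> * (norm p')\<^sup>2" using min[of p'] fp' by simp
  \<comment> \<open>The nonnegative quadratic form \<open>f p - \<mu> * (norm p)\<^sup>2\<close>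
    vanishes at \<open>p'\<close>, and \<open>d\<close> is half its gradient there. Moving from
    \<open>p'\<close> along \<open>d\<close> shows that the gradient is zero.\<close>
  define d where "d = weighted_gram x p' - \<mu> *\<^sub>R p'"
  define c where "c = f d - \<mu> * (norm d)\<^sup>2"
  have c: "0 \<le> c" using min[of d] by (simp add: c_def)
  define D where "D = d \<bullet> d"
  have D: "0 \<le> D" by (simp add: D_def)
  have quad: "0 \<le> 2 * t * D + t\<^sup>2 * c" for t
  proof -
    define W where "W = weighted_gram x p' \<bullet> d"
    define I where "I = p' \<bullet> d"
    have "W - \<mu> * I = (weighted_gram x p' - \<mu> *\<^sub>R p') \<bullet> d"
      by (simp add: W_def I_def inner_diff_left)
    then have WI: "W = D + \<mu> * I" by (simp add: d_def[symmetric] D_def)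
    have "weighted_gram x d \<bullet> p' = W"
      using weighted_gram_sym[of x d p'] by (simp add: W_def inner_commute)
    then have 1: "f (p' + t *\<^sub>R d) = f p' + 2 * t * W + t\<^sup>2 * f d"
      unfolding f_def weighted_gram_add weighted_gram_scale inner_add_left inner_add_right
        inner_scaleR_left inner_scaleR_right W_def[symmetric]
      by (simp add: power2_eq_square algebra_simps)
    have "d \<bullet> p' = I" by (simp add: I_def inner_commute)
    then have 2: "(norm (p' + t *\<^sub>R d))\<^sup>2 = (norm p')\<^sup>2 + 2 * t * I + t\<^sup>2 * (norm d)\<^sup>2"
      unfolding power2_norm_eq_inner inner_add_left inner_add_right inner_scaleR_left
        inner_scaleR_right I_def[symmetric]
      by (simp add: power2_eq_square algebra_simps)
    have "\<mu> * (norm (p' + t *\<^sub>R d))\<^sup>2 \<le> f (p' + t *\<^sub>R d)" by (rule min)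
    then show ?thesis
      unfolding 1 2 fp'' c_def WI by (simp add: distrib_left right_diff_distrib mult_ac)
  qed
  have "D = 0"
  proof (rule ccontr)
    assume "D \<noteq> 0"
    then have "0 < D" using D by simp
    \<comment> \<open>At \<open>t = - s\<close> the lower bound becomes
      \<open>- s * D - s * s\<close>, which is negative. The summand 1 keeps the denominator
      positive when \<open>c = 0\<close>.\<close>
    define s where "s = D / (c + 1)"
    have "0 < s" using \<open>0 < D\<close> c by (simp add: s_def)
    have "s * (c + 1) = D" using c by (simp add: s_def)
    then have "s * c = D - s" unfolding distrib_left by simp
    then have "s\<^sup>2 * c = s * D - s * s" by (simp add: power2_eq_square mult.assoc right_diff_distrib)
    then have "0 \<le> - (s * D) - s * s" using quad[of "- s"] by (simp add: mult.commute)
    moreover have "0 < s * D" "0 < s * s" using \<open>0 < s\<close> \<open>0 < D\<close> by simp_all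
    ultimately show False by linarith
  qed
  then have eig: "weighted_gram x p' = \<mu> *\<^sub>R p'" by (simp add: D_def d_def)
  have "p' \<noteq> 0" using p'1 by auto
  have "0 < \<mu>"
  proof (rule ccontr)
    assume "\<not> 0 < \<mu>"
    then have "\<mu> = 0" using \<mu>0 by simp
    then have "x $ i * (n i \<bullet> p') = 0" for i using weighted_gram_eigen_iff[THEN iffD1, OF eig] by simp
    then have "n i \<bullet> p' = 0" for i using x[of i] by (metis mult_eq_0_iff order_less_irrefl)
    then show False using separating \<open>p' \<noteq> 0\<close> by blast
  qed
  have "0 < n i \<bullet> p'" for i
  proof -
    have "0 < \<mu> * (q i \<bullet> p')"
      using \<open>0 < \<mu>\<close> \<open>p' \<noteq> 0\<close> by (intro mult_pos_pos inner_q_pos_of_nonneg) (simp_all add: np')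
    then have "0 < x $ i * (n i \<bullet> p')" using weighted_gram_eigen_iff[THEN iffD1, OF eig] by simp
    then show ?thesis using x[of i] by (simp add: zero_less_mult_iff)
  qed
  then have "(1 / norm p') *\<^sub>R p' \<in> open_chamber" using \<open>p' \<noteq> 0\<close> by (simp add: open_chamber_def)
  moreover have "norm ((1 / norm p') *\<^sub>R p') = 1" using \<open>p' \<noteq> 0\<close> by simp
  moreover have "weighted_gram x ((1 / norm p') *\<^sub>R p') = \<mu> *\<^sub>R ((1 / norm p') *\<^sub>R p')"
    by (simp add: weighted_gram_scale eig)
  ultimately show thesis by (rule that)
qed

section \<open>Eigenvalue and weights as rational functions of the chamber point\<close>

definition eigval :: "'a \<Rightarrow> real" where
  "eigval p = inverse (\<Sum>i\<in>UNIV. (q i \<bullet> p) / (n i \<bullet> p))"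

definition eigweights :: "'a \<Rightarrow> real ^ 'k" where
  "eigweights p = (\<chi> i. eigval p * ((q i \<bullet> p) / (n i \<bullet> p)))"

text \<open>The diagonal term alone gives at least 1, because Cauchy-Schwarz applied to
  \<open>n i \<bullet> q i = 1\<close> yields \<open>norm (q i) \<ge> 1\<close>. A second index,
  present by \<open>rank\<close>, adds something strictly positive.\<close>

lemma ratio_gt_1:
  assumes "p \<in> open_chamber"
  shows "1 < (q i \<bullet> p) / (n i \<bullet> p)"
proof -
  have np: "0 < n i \<bullet> p" for i using assms by (simp add: open_chamber_def)
  have "CARD('k) \<noteq> card {i}" using rank by simp
  then obtain j where j: "j \<noteq> i" by (metis UNIV_I UNIV_eq_I singleton_iff)
  have "1 \<le> norm (q i)" using norm_cauchy_schwarz[of "n i" "q i"] by (simp add: norm_n dual)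
  then have "1 \<le> q i \<bullet> q i"
    using mult_mono[of 1 "norm (q i)" 1 "norm (q i)"] by (simp add: power2_norm_eq_inner[symmetric] power2_eq_square)
  then have "n i \<bullet> p \<le> (n i \<bullet> p) * (q i \<bullet> q i)" using np[of i] by simp
  also have "\<dots> < (n i \<bullet> p) * (q i \<bullet> q i) + (\<Sum>l\<in>UNIV - {i}. (n l \<bullet> p) * (q l \<bullet> q i))"
  proof -
    have "0 < (\<Sum>l\<in>UNIV - {i}. (n l \<bullet> p) * (q l \<bullet> q i))"
      by (rule sum_pos) (use j np inner_q_pos in auto)
    then show ?thesis by simp
  qed
  also have "\<dots> = q i \<bullet> p"
    using expand_inner[of p "q i"] by (subst (asm) sum.remove[of _ i]) (simp_all add: inner_commute)
  finally show ?thesis using np[of i] by simp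
qed

lemma eigval_bounds:
  assumes "p \<in> open_chamber"
  shows "0 < eigval p" "eigval p < 1 / 2"
proof -
  have "real CARD('k) < (\<Sum>i\<in>UNIV. (q i \<bullet> p) / (n i \<bullet> p))"
    using sum_strict_mono[of "UNIV :: 'k set" "\<lambda>_. 1" "\<lambda>i. (q i \<bullet> p) / (n i \<bullet> p)"] ratio_gt_1[OF assms]
    by simp
  then have "2 < (\<Sum>i\<in>UNIV. (q i \<bullet> p) / (n i \<bullet> p))" using rank by linarith
  then show "0 < eigval p" "eigval p < 1 / 2"
    using less_imp_inverse_less[of 2 "\<Sum>i\<in>UNIV. (q i \<bullet> p) / (n i \<bullet> p)"]
    unfolding eigval_def by simp_all
qed

lemma eigweights_eigen:
  assumes "p \<in> open_chamber"
  shows "weighted_gram (eigweights p) p = eigval p *\<^sub>R p"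
proof -
  have "n i \<bullet> p \<noteq> 0" for i by (rule open_chamberD(2)[OF assms])
  then show ?thesis
    unfolding weighted_gram_eigen_iff eigweights_def vec_lambda_beta by simp
qed

lemma eigweights_in:
  assumes "p \<in> open_chamber"
  shows "eigweights p \<in> int_weights"
proof -
  have "0 < eigweights p $ i" for i
    using eigval_bounds(1)[OF assms] ratio_gt_1[OF assms, of i]
    by (simp only: eigweights_def vec_lambda_beta) (intro mult_pos_pos, auto)
  moreover have "(\<Sum>i\<in>UNIV. eigweights p $ i) = 1"
  proof -
    have "(\<Sum>i\<in>UNIV. eigweights p $ i) = eigval p * (\<Sum>i\<in>UNIV. (q i \<bullet> p) / (n i \<bullet> p))"
      by (simp add: eigweights_def sum_distrib_left)
    also have "\<dots> = 1"
      using eigval_bounds(1)[OF assms] unfolding eigval_def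
      by (intro left_inverse) (metis inverse_zero order_less_irrefl)
    finally show ?thesis .
  qed
  ultimately show ?thesis by (simp add: int_weights_def weights_def less_imp_le)
qed

text \<open>Solving the eigenvalue equation for \<open>x $ i\<close> leaves only the factor
  \<open>\<nu>\<close> free, and the normalisation of the weights fixes it. This is where the
  formulas for \<open>eigval\<close> and \<open>eigweights\<close> come from.\<close>

lemma eigen_imp_eigweights:
  assumes "p \<in> open_chamber" "weighted_gram x p = \<nu> *\<^sub>R p" "(\<Sum>i\<in>UNIV. x $ i) = 1"
  shows "eigval p = \<nu>" "eigweights p = x"
proof -
  have "n i \<bullet> p \<noteq> 0" for i by (rule open_chamberD(2)[OF assms(1)])
  then have x: "x $ i = \<nu> * ((q i \<bullet> p) / (n i \<bullet> p))" for i
    using assms(2)[unfolded weighted_gram_eigen_iff] nonzero_eq_divide_eq[of "n i \<bullet> p" "x $ i"] by simp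
  then have "\<nu> * (\<Sum>i\<in>UNIV. (q i \<bullet> p) / (n i \<bullet> p)) = 1"
    using assms(3) by (simp add: sum_distrib_left)
  then show "eigval p = \<nu>" by (metis eigval_def inverse_unique mult.commute)
  then show "eigweights p = x" by (simp add: eigweights_def vec_eq_iff x)
qed

lemma bij_betw_eigweights: "bij_betw eigweights (open_chamber \<inter> sphere 0 1) int_weights"
  unfolding bij_betw_def
proof
  show "inj_on eigweights (open_chamber \<inter> sphere 0 1)"
  proof (rule inj_onI)
    fix p p' assume p: "p \<in> open_chamber \<inter> sphere 0 1" and p': "p' \<in> open_chamber \<inter> sphere 0 1"
      and eq: "eigweights p = eigweights p'"
    have e: "weighted_gram (eigweights p) p = eigval p *\<^sub>R p"
      "weighted_gram (eigweights p) p' = eigval p' *\<^sub>R p'"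
      using eigweights_eigen p eigweights_eigen[of p', folded eq] p' by auto
    then have "eigval p' = eigval p" using eigenvalue_unique[OF _ e(1) _ e(2)] p p' by simp
    moreover have "0 < eigweights p $ i" for i
      using eigweights_in p by (auto simp: int_weights_def)
    ultimately obtain c where c: "p' = c *\<^sub>R p"
      using eigenvector_unique[of "eigweights p" p "eigval p" p'] e p by (metis IntD1)
    \<comment> \<open>Two chamber points make an acute angle, so the scalar is positive; unit norms
      then force it to be 1.\<close>
    have "0 < p \<bullet> p'" using open_chamber_inner_pos p p' by auto
    then have "0 < c" using c inner_ge_zero[of p] by (auto simp: zero_less_mult_iff)
    then show "p = p'" using c p p' by simp
  qed
  show "eigweights ` (open_chamber \<inter> sphere 0 1) = int_weights"
  proof (intro equalityI subsetI)
    fix x :: "real ^ 'k" assume x: "x \<in> int_weights"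
    then have "0 < x $ i" for i by (simp add: int_weights_def)
    then obtain p \<nu> where "p \<in> open_chamber" "norm p = 1" "weighted_gram x p = \<nu> *\<^sub>R p"
      by (rule eigenvector_exists)
    moreover have "(\<Sum>i\<in>UNIV. x $ i) = 1" using x by (simp add: int_weights_def weights_def)
    ultimately have "eigweights p = x" "p \<in> open_chamber \<inter> sphere 0 1"
      using eigen_imp_eigweights(2) by auto
    then show "x \<in> eigweights ` (open_chamber \<inter> sphere 0 1)" by blast
  qed (use eigweights_in in auto)
qed

lemma Ck_on_eigval: "Ck_on r open_chamber eigval"
proof -
  have np: "n i \<bullet> p \<noteq> 0" if "p \<in> open_chamber" for i p
    using that by (rule open_chamberD)
  have "(\<Sum>i\<in>UNIV. (q i \<bullet> p) / (n i \<bullet> p)) \<noteq> 0" if "p \<in> open_chamber" for p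
    using eigval_bounds(1)[OF that] unfolding eigval_def by (metis inverse_zero order_less_irrefl)
  moreover have "Ck_on r open_chamber (\<lambda>p. \<Sum>i\<in>UNIV. (q i \<bullet> p) / (n i \<bullet> p))"
    by (rule Ck_on_sum[OF open_open_chamber finite], rule Ck_on_divide[OF open_open_chamber])
       (rule Ck_on_linear[OF open_open_chamber bounded_linear_inner_right] np, assumption?)+
  ultimately show ?thesis
    unfolding eigval_def[abs_def] using Ck_on_inverse[OF open_open_chamber] by blast
qed

lemma Ck_on_eigweights: "Ck_on r open_chamber eigweights"
proof -
  have np: "n i \<bullet> p \<noteq> 0" if "p \<in> open_chamber" for i p
    using that by (rule open_chamberD)
  show ?thesis
    unfolding eigweights_def[abs_def]
    by (rule Ck_on_vec[OF open_open_chamber], rule Ck_on_mult[OF open_open_chamber Ck_on_eigval],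
        rule Ck_on_divide[OF open_open_chamber])
       (rule Ck_on_linear[OF open_open_chamber bounded_linear_inner_right] np, assumption?)+
qed

text \<open>Junk unless \<open>x\<close> has an eigenvector in the chamber, which all positive \<open>x\<close> have.\<close>

definition perron :: "real ^ 'k \<Rightarrow> real" where
  "perron x = (THE \<nu>. \<exists>p\<in>open_chamber. weighted_gram x p = \<nu> *\<^sub>R p)"

lemma perron_eqI:
  assumes "p \<in> open_chamber" "weighted_gram x p = \<nu> *\<^sub>R p"
  shows "perron x = \<nu>"
  unfolding perron_def
proof (rule the_equality)
  show "\<exists>p\<in>open_chamber. weighted_gram x p = \<nu> *\<^sub>R p" using assms by blast
  show "\<nu>' = \<nu>" if "\<exists>p\<in>open_chamber. weighted_gram x p = \<nu>' *\<^sub>R p" for \<nu>'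
    using that eigenvalue_unique[OF assms] by metis
qed

text \<open>Writing a nearby eigenvector as \<open>p + u\<close> with \<open>u\<close> orthogonal to \<open>p\<close> and the eigenvalue as
  \<open>\<nu> + \<tau>\<close>, the eigenvalue equation becomes quadratic in \<open>(h, u, \<tau>)\<close>. Its linear part \<open>L\<close> is
  invertible because \<open>\<nu>\<close> is a simple eigenvalue.\<close>

lemma real_analytic_at_perron:
  assumes a: "\<And>i. 0 < a $ i"
  shows "real_analytic_at (\<lambda>x. 1 - 2 * perron x) a"
proof -
  obtain p \<nu> where p: "p \<in> open_chamber" "norm p = 1" "weighted_gram a p = \<nu> *\<^sub>R p"
    by (rule eigenvector_exists[OF a])
  \<comment> \<open>The extra unknown \<open>\<tau>\<close> balances the extra equation
    \<open>p \<bullet> u = 0\<close>, so the linear system is square and injectivity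
    suffices.\<close>
  define L :: "'a \<times> real \<Rightarrow> 'a \<times> real" where
    "L = (\<lambda>(u, \<tau>). (weighted_gram a u - \<nu> *\<^sub>R u - \<tau> *\<^sub>R p, p \<bullet> u))"
  have linL: "linear L"
    by (rule linearI) (auto simp: L_def weighted_gram_add weighted_gram_scale inner_add_right algebra_simps)
  have "inj L"
  proof (subst linear_injective_0[OF linL], intro allI impI)
    fix z assume "L z = 0"
    then obtain u \<tau> where z: "z = (u, \<tau>)" and 1: "weighted_gram a u - \<nu> *\<^sub>R u = \<tau> *\<^sub>R p" and 2: "p \<bullet> u = 0"
      by (cases z) (auto simp: L_def zero_prod_def)
    \<comment> \<open>By symmetry the image of \<open>weighted_gram a - \<nu>\<close> is orthogonal
      to \<open>p\<close>, which kills \<open>\<tau>\<close>; simplicity of the eigenvalue then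
      kills \<open>u\<close>.\<close>
    have "p \<bullet> (weighted_gram a u - \<nu> *\<^sub>R u) = 0"
      using weighted_gram_sym[of a p u] by (simp add: inner_diff_right p(3) 2)
    then have "\<tau> = 0" using p(2) by (simp add: 1 power2_norm_eq_inner[symmetric])
    then have "weighted_gram a u = \<nu> *\<^sub>R u" using 1 by simp
    then obtain c where "u = c *\<^sub>R p" by (rule eigenvector_unique[OF a p(1,3)])
    then have "u = 0" using 2 p(2) by (auto simp: power2_norm_eq_inner[symmetric])
    then show "z = 0" using z \<open>\<tau> = 0\<close> by (simp add: zero_prod_def)
  qed
  then obtain M where M: "linear M" "\<And>z. L (M z) = z"
    using linear_injective_isomorphism[OF linL] by blast
  \<comment> \<open>The parameter \<open>h\<close> is carried inside the unknown, so that the mixed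
    term \<open>weighted_gram h u\<close> becomes part of a bilinear map of the unknown with itself.
    The zero first component ensures that the solution returns \<open>h\<close> unchanged.\<close>
  define B :: "(real ^ 'k) \<times> 'a \<times> real \<Rightarrow> (real ^ 'k) \<times> 'a \<times> real \<Rightarrow> (real ^ 'k) \<times> 'a \<times> real" where
    "B = (\<lambda>(h, u, \<tau>) (h', u', \<tau>'). (0, M (\<tau> *\<^sub>R u' - weighted_gram h u', 0)))"
  define \<iota> where "\<iota> h = (h, M (- weighted_gram h p, 0))" for h
  have M_add: "M (u + u', 0) = M (u, 0) + M (u', 0)" for u u'
    using linear_add[OF M(1), of "(u, 0)" "(u', 0)"] by simp
  have M_scale: "M (c *\<^sub>R u, 0) = c *\<^sub>R M (u, 0)" for c u
    using linear_cmul[OF M(1), of c "(u, 0)"] by simp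
  have "bilinear B"
    unfolding bilinear_def
  proof (intro conjI allI linearI)
    fix z w w' :: "(real ^ 'k) \<times> 'a \<times> real" and c :: real
    obtain h u \<tau> where z: "z = (h, u, \<tau>)" by (cases z)
    obtain k v \<sigma> where w: "w = (k, v, \<sigma>)" by (cases w)
    obtain k' v' \<sigma>' where w': "w' = (k', v', \<sigma>')" by (cases w')
    show "B z (w + w') = B z w + B z w'"
      unfolding z w w' by (simp add: B_def M_add[symmetric] weighted_gram_add algebra_simps)
    show "B z (c *\<^sub>R w) = c *\<^sub>R B z w"
      unfolding z w by (simp add: B_def M_scale[symmetric] weighted_gram_scale algebra_simps)
    show "B (w + w') z = B w z + B w' z"
      unfolding z w w' by (simp add: B_def M_add[symmetric] weighted_gram_add_left algebra_simps)
    show "B (c *\<^sub>R w) z = c *\<^sub>R B w z"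
      unfolding z w by (simp add: B_def M_scale[symmetric] weighted_gram_scale_left algebra_simps)
  qed
  then have bilB: "bounded_bilinear B" by (simp add: bilinear_conv_bounded_bilinear)
  have lin\<iota>: "linear \<iota>"
  proof (rule linearI)
    show "\<iota> (h + h') = \<iota> h + \<iota> h'" for h h'
      by (simp add: \<iota>_def weighted_gram_add_left M_add[symmetric])
    show "\<iota> (c *\<^sub>R h) = c *\<^sub>R \<iota> h" for c h
      by (simp add: \<iota>_def weighted_gram_scale_left M_scale[symmetric])
  qed
  \<comment> \<open>Half the smallest root coordinate of \<open>p\<close>: a correction of this size
    cannot carry \<open>p + u\<close> out of the chamber, so its eigenvalue is
    \<open>perron x\<close>.\<close>
  define \<epsilon> where "\<epsilon> = Min (range (\<lambda>i. n i \<bullet> p)) / 2"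
  have np: "0 < n i \<bullet> p" for i using p(1) by (simp add: open_chamber_def)
  then have "0 < Min (range (\<lambda>i. n i \<bullet> p))" by (subst Min_gr_iff) auto
  then have \<epsilon>: "0 < \<epsilon>" by (simp add: \<epsilon>_def)
  have \<epsilon>_less: "\<epsilon> < n i \<bullet> p" for i
  proof -
    have "Min (range (\<lambda>i. n i \<bullet> p)) \<le> n i \<bullet> p" by simp
    then show ?thesis using np[of i] unfolding \<epsilon>_def by linarith
  qed
  obtain r Z where r: "0 < r" and Z: "power_series_bounded r \<epsilon> Z"
    and eqn: "\<forall>h. (\<forall>i. \<bar>h $ i\<bar> \<le> r) \<longrightarrow> Z h = \<iota> h + B (Z h) (Z h)"
    by (rule power_series_quadratic_fixpoint[OF bilB lin\<iota> \<epsilon>])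
  define g :: "(real ^ 'k) \<times> 'a \<times> real \<Rightarrow> real" where "g z = (- 2) * snd (snd z)" for z
  have "bounded_linear g"
    unfolding g_def
    by (intro bounded_linear_const_mult bounded_linear_compose[OF bounded_linear_snd bounded_linear_snd])
  moreover have "1 - 2 * perron x = (1 - 2 * \<nu>) + g (Z (x - a))" if x: "x \<in> ball a r" for x
  proof -
    define h where "h = x - a"
    have h: "\<bar>h $ i\<bar> \<le> r" for i
      using component_le_norm_cart[of h i] x by (simp add: h_def dist_norm norm_minus_commute)
    obtain h' u \<tau> where Zh: "Z h = (h', u, \<tau>)" by (cases "Z h")
    have h': "h' = h" and M': "(u, \<tau>) = M (- weighted_gram h p, 0) + M (\<tau> *\<^sub>R u - weighted_gram h' u, 0)"
      using eqn[rule_format, OF h] unfolding Zh by (simp_all add: \<iota>_def B_def)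
    have "L (u, \<tau>) = (\<tau> *\<^sub>R u - weighted_gram h p - weighted_gram h u, 0)"
      by (subst M', subst M_add[symmetric], subst M(2)) (simp add: h' algebra_simps)
    then have "weighted_gram (a + h) (p + u) = (\<nu> + \<tau>) *\<^sub>R (p + u)"
      using p(3) by (simp add: L_def weighted_gram_add weighted_gram_add_left algebra_simps)
    moreover have "a + h = x" by (simp add: h_def)
    moreover have "p + u \<in> open_chamber"
      unfolding open_chamber_def
    proof (intro CollectI allI)
      fix i
      have "norm (u, \<tau>) \<le> norm (Z h)" unfolding Zh by (rule norm_snd_le)
      then have "norm u \<le> norm (Z h)" using norm_fst_le[of u \<tau>] by linarith
      also have "\<dots> \<le> \<epsilon>" by (rule power_series_bounded_norm_le[OF Z h])
      finally have "norm u \<le> \<epsilon>" .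
      moreover have "\<bar>n i \<bullet> u\<bar> \<le> norm u" using Cauchy_Schwarz_ineq2[of "n i" u] by (simp add: norm_n)
      ultimately show "0 < n i \<bullet> (p + u)" using \<epsilon>_less[of i] by (simp add: inner_add_right)
    qed
    ultimately have "perron x = \<nu> + \<tau>" using perron_eqI by metis
    then show ?thesis unfolding h_def[symmetric] by (simp add: Zh g_def)
  qed
  ultimately show ?thesis by (intro real_analytic_at_linear_power_series[OF r Z])
qed

end

section \<open>Determinants and dual vectors\<close>

text \<open>\<open>pos\<close> inverts the sorted enumeration of the index type, which links
  positions in lists with rows of matrices.\<close>

lemma pos_sorted_list_nth:
  assumes "k < CARD('k::{finite, linorder})"
  shows "pos (sorted_list_of_set (UNIV :: 'k set) ! k) = k"
proof -
  define xs where "xs = sorted_list_of_set (UNIV :: 'k set)"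
  have xs: "sorted_wrt (<) xs" "set xs = UNIV" "distinct xs" "length xs = CARD('k)"
    by (simp_all add: xs_def)
  have less: "xs ! i < xs ! j \<longleftrightarrow> i < j" if "i < length xs" "j < length xs" for i j
    using sorted_wrt_nth_less[OF xs(1)] that by (metis linorder_neqE_nat order_less_asym order_less_irrefl)
  have "{i. i < xs ! k} = (!) xs ` {..<k}"
  proof (intro equalityI subsetI)
    fix x assume "x \<in> {i. i < xs ! k}"
    moreover obtain l where "l < length xs" "x = xs ! l" using xs(2) by (metis UNIV_I in_set_conv_nth)
    ultimately show "x \<in> (!) xs ` {..<k}" using less[of l k] assms xs(4) by auto
  next
    fix x assume "x \<in> (!) xs ` {..<k}"
    then show "x \<in> {i. i < xs ! k}" using less[of _ k] assms xs(4) by auto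
  qed
  moreover have "inj_on ((!) xs) {..<k}"
    using xs(3,4) assms by (intro inj_onI) (simp add: nth_eq_iff_index_eq)
  ultimately show ?thesis by (simp add: pos_def card_image flip: xs_def)
qed

lemma pos_less: "pos (j :: 'k::{finite, linorder}) < CARD('k)"
  unfolding pos_def by (rule psubset_card_mono) auto

lemma sorted_list_nth_pos: "sorted_list_of_set UNIV ! pos j = (j :: 'k::{finite, linorder})"
proof -
  obtain k where "k < CARD('k)" "j = sorted_list_of_set UNIV ! k"
    by (metis UNIV_I finite in_set_conv_nth length_sorted_list_of_set set_sorted_list_of_set)
  then show ?thesis using pos_sorted_list_nth by metis
qed

lemma pos_eq_iff: "pos i = pos j \<longleftrightarrow> i = (j :: 'k::{finite, linorder})"
  by (metis sorted_list_nth_pos)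

lemma ex_pos:
  assumes "k < CARD('k)"
  obtains r :: "'k::{finite, linorder}" where "pos r = k"
  using pos_sorted_list_nth[OF assms] by blast

definition det_list :: "(real ^ ('k::{finite, linorder})) list \<Rightarrow> real" where
  "det_list vs = det (\<chi> r :: 'k. vs ! pos r)"

lemma det_list_swap:
  fixes us ws :: "(real ^ ('k::{finite, linorder})) list"
  assumes "length us + length ws + 2 = CARD('k)"
  shows "det_list (us @ a # b # ws) = - det_list (us @ b # a # ws)"
proof -
  have "length us < CARD('k)" "Suc (length us) < CARD('k)" using assms by auto
  then obtain r1 r2 :: 'k where r1: "pos r1 = length us" and r2: "pos r2 = Suc (length us)"
    using ex_pos[where 'k='k] by metis
  have "r1 \<noteq> r2" using r1 r2 by auto
  have "(us @ a # b # ws) ! pos r = (us @ b # a # ws) ! pos (Transposition.transpose r1 r2 r)" for r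
  proof -
    consider "r = r1" | "r = r2" | "pos r \<noteq> length us" "pos r \<noteq> Suc (length us)" "r \<noteq> r1" "r \<noteq> r2"
      using r1 r2 pos_eq_iff by metis
    then show ?thesis
    proof cases
      case 3
      then show ?thesis
        by (auto simp: nth_append nth_Cons' transpose_def)
    qed (simp_all add: r1 r2 nth_append)
  qed
  then have "det_list (us @ a # b # ws) =
      det (\<chi> r. (\<chi> r. (us @ b # a # ws) ! pos r) $ Transposition.transpose r1 r2 r)"
    by (simp add: det_list_def)
  also have "\<dots> = of_int (sign (Transposition.transpose r1 r2)) * det_list (us @ b # a # ws)"
    unfolding det_list_def by (rule det_permute_rows) (rule permutes_swap_id, simp_all)
  finally show ?thesis using \<open>r1 \<noteq> r2\<close> by (simp add: sign_swap_id)
qed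

text \<open>The vector \<open>a\<close> passes the vectors of \<open>us\<close> by adjacent row
  swaps, one sign for each.\<close>

lemma det_list_move:
  fixes us vs ws :: "(real ^ ('k::{finite, linorder})) list"
  assumes "length vs + length us + length ws + 1 = CARD('k)"
  shows "det_list (vs @ a # us @ ws) = (- 1) ^ length us * det_list (vs @ us @ a # ws)"
  using assms
proof (induction us arbitrary: vs)
  case (Cons u us)
  have "det_list (vs @ a # u # us @ ws) = - det_list (vs @ u # a # us @ ws)"
    using Cons.prems by (intro det_list_swap) simp
  also have "\<dots> = - ((- 1) ^ length us * det_list (vs @ u # us @ a # ws))"
    using Cons.IH[of "vs @ [u]"] Cons.prems by simp
  finally show ?case by simp
qed simp

text \<open>Expand \<open>v\<close> in the standard basis and use linearity of the determinant in
  its first row.\<close>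

lemma inner_cross_product:
  fixes v :: "real ^ ('k::{finite, linorder})"
  shows "v \<bullet> cross_product vs = det_list (v # vs)"
proof -
  obtain r0 :: 'k where r0: "pos r0 = 0" by (rule ex_pos[OF zero_less_card_finite])
  have row: "(\<chi> r :: 'k. (w # vs) ! pos r) = (\<chi> r. if r = r0 then w else vs ! (pos r - 1))" for w
    using r0 pos_eq_iff[of _ r0] by (auto simp: vec_eq_iff nth_Cons')
  have "v \<bullet> cross_product vs = (\<Sum>i\<in>UNIV. det (\<chi> r. if r = r0 then v $ i *s axis i 1 else vs ! (pos r - 1)))"
    by (simp add: cross_product_def inner_vec_def row det_row_mul)
  also have "\<dots> = det (\<chi> r. if r = r0 then (\<Sum>i\<in>UNIV. v $ i *s axis i 1) else vs ! (pos r - 1))"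
    by (rule det_linear_row_sum[symmetric]) simp
  also have "\<dots> = det_list (v # vs)"
    unfolding det_list_def row basis_expansion ..
  finally show ?thesis .
qed

lemma inner_dual_vec:
  fixes n :: "'k::{finite, linorder} \<Rightarrow> real ^ ('k::{finite, linorder})"
  shows "n i \<bullet> dual_vec n j = (if i = j then root_det n else 0)"
proof -
  define xs where "xs = sorted_list_of_set (UNIV :: 'k set)"
  define us where "us = take (pos j) xs"
  define ws where "ws = drop (Suc (pos j)) xs"
  have len: "length xs = CARD('k)" by (simp add: xs_def)
  have xs: "xs = us @ j # ws"
    unfolding us_def ws_def
    using id_take_nth_drop[of "pos j" xs] pos_less[of j] len sorted_list_nth_pos[of j] by (simp add: xs_def)
  have "distinct xs" by (simp add: xs_def)
  then have "filter (\<lambda>i. i \<noteq> j) us = us" "filter (\<lambda>i. i \<noteq> j) ws = ws"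
    unfolding xs filter_id_conv by auto
  then have filt: "filter (\<lambda>i. i \<noteq> j) xs = us @ ws"
    unfolding xs by simp
  have us: "length us = pos j" using pos_less[of j] len by (simp add: us_def)
  have inner: "n i \<bullet> dual_vec n j = (- 1) ^ pos j * det_list (n i # map n us @ map n ws)"
    unfolding dual_vec_def xs_def[symmetric] filt by (simp add: inner_cross_product)
  show ?thesis
  proof (cases "i = j")
    case True
    have "det_list (n j # map n us @ map n ws) = (- 1) ^ pos j * det_list (map n xs)"
      using det_list_move[of "[]" "map n us" "map n ws" "n j"] len us xs by simp
    moreover have "det_list (map n xs) = root_det n"
    proof -
      have "map n xs ! pos r = n r" for r
        using pos_less[of r] len sorted_list_nth_pos[of r] by (simp add: xs_def)
      then have "det_list (map n xs) = det (\<chi> r. n r)" by (simp only: det_list_def)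
      \<comment> \<open>\<open>root_det\<close> has the roots as columns, \<open>det_list\<close> as
        rows.\<close>
      also have "(\<chi> r. n r) = transpose (\<chi> i j. n j $ i)" by (simp add: transpose_def vec_eq_iff)
      finally show ?thesis by (simp add: root_det_def det_transpose)
    qed
    \<comment> \<open>The sign in \<open>dual_vec\<close> cancels the sign from moving the row of
      \<open>n j\<close> back to its sorted place.\<close>
    ultimately show ?thesis
      using inner True by (simp flip: power_mult_distrib mult.assoc)
  next
    case False
    have "i \<in> set xs" by (simp add: xs_def)
    then have "i \<in> set (us @ ws)" using False xs by auto
    then obtain k where k: "k < length (us @ ws)" "(us @ ws) ! k = i" by (metis in_set_conv_nth)
    have "Suc k < CARD('k)" using k len xs by simp
    then obtain r :: 'k where r: "pos r = Suc k" by (rule ex_pos)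
    obtain r0 :: 'k where r0: "pos r0 = 0" by (rule ex_pos[OF zero_less_card_finite])
    have "r \<noteq> r0" using r r0 by auto
    moreover have "(map n (us @ ws)) ! k = n i" using k by (simp only: nth_map)
    then have "row r (\<chi> r. (n i # map n us @ map n ws) ! pos r) = row r0 (\<chi> r. (n i # map n us @ map n ws) ! pos r)"
      by (simp add: row_def r r0)
    ultimately have "det_list (n i # map n us @ map n ws) = 0"
      unfolding det_list_def by (rule det_identical_rows)
    then show ?thesis using inner False by simp
  qed
qed

section \<open>Coxeter groups acting by reflections\<close>

locale coxeter_representation = group G
  for G :: "('g, 'b) monoid_scheme" (structure) +
  fixes s :: "'k \<Rightarrow> 'g" and m :: "'k \<Rightarrow> 'k \<Rightarrow> nat"
    and n :: "'k \<Rightarrow> 'a::real_inner" and \<rho> :: "'g \<Rightarrow> 'a \<Rightarrow> 'a"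
  assumes s_closed: "s i \<in> carrier G"
    and s_square: "s i \<otimes> s i = \<one>"
    and braid: "i \<noteq> j \<Longrightarrow> (s i \<otimes> s j) [^] m i j = \<one>"
    and generated: "generate G (range s) = carrier G"
    and m_ge: "i \<noteq> j \<Longrightarrow> 2 \<le> m i j"
    and norm_n: "norm (n i) = 1"
    and gram: "i \<noteq> j \<Longrightarrow> n i \<bullet> n j = - cos (pi / real (m i j))"
    and \<rho>_mult: "x \<in> carrier G \<Longrightarrow> y \<in> carrier G \<Longrightarrow> \<rho> (x \<otimes> y) = \<rho> x \<circ> \<rho> y"
    and \<rho>_orthogonal: "x \<in> carrier G \<Longrightarrow> orthogonal_transformation (\<rho> x)"
    and \<rho>_s: "\<rho> (s i) = reflection (n i)"
begin

declare s_closed [simp]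

section \<open>Words, length and alternating products\<close>

lemma mult_s_s: "g \<in> carrier G \<Longrightarrow> g \<otimes> s i \<otimes> s i = g"
  by (simp add: m_assoc s_square)

lemma inv_s: "inv (s i) = s i"
  by (rule inv_equality) (simp_all add: s_square)

text \<open>Letters are read from the end of the list, so that \<open>Cons\<close> multiplies on the right.\<close>

primrec word :: "'k list \<Rightarrow> 'g" where
  "word [] = \<one>"
| "word (i # w) = word w \<otimes> s i"

lemma word_closed [simp]: "word w \<in> carrier G"
  by (induction w) auto

lemma word_append: "word (v @ w) = word w \<otimes> word v"
  by (induction v) (simp_all add: m_assoc)

lemma ex_word:
  assumes "g \<in> carrier G"
  shows "\<exists>w. word w = g"
proof -
  have "g \<in> generate G (range s)" using assms generated by simp
  then show ?thesis
  proof (induction rule: generate.induct)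
    case one
    show ?case by (rule exI[of _ "[]"]) simp
  next
    case (incl h)
    then obtain i where "h = s i" by blast
    then show ?case by (intro exI[of _ "[i]"]) simp
  next
    case (inv h)
    then obtain i where "h = s i" by blast
    then show ?case by (intro exI[of _ "[i]"]) (simp add: inv_s)
  next
    case (eng h1 h2)
    then show ?case using word_append by metis
  qed
qed

definition len :: "'g \<Rightarrow> nat" where
  "len g = (LEAST k. \<exists>w. length w = k \<and> word w = g)"

lemma len_le: "word w = g \<Longrightarrow> len g \<le> length w"
  unfolding len_def by (rule Least_le) blast

lemma ex_reduced_word:
  assumes "g \<in> carrier G"
  obtains w where "length w = len g" "word w = g"
proof -
  have "\<exists>k w. length w = k \<and> word w = g" using ex_word[OF assms] by blast
  from LeastI_ex[OF this] show thesis using that unfolding len_def by blast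
qed

lemma len_mult_s_le:
  assumes "g \<in> carrier G"
  shows "len (g \<otimes> s i) \<le> Suc (len g)"
proof -
  obtain w where "length w = len g" "word w = g" by (rule ex_reduced_word[OF assms])
  then show ?thesis using len_le[of "i # w" "g \<otimes> s i"] by simp
qed

lemma len_le_mult_s: "g \<in> carrier G \<Longrightarrow> len g \<le> Suc (len (g \<otimes> s i))"
  using len_mult_s_le[of "g \<otimes> s i" i] by (simp add: mult_s_s)

lemma ex_descent:
  assumes "g \<in> carrier G" "g \<noteq> \<one>"
  obtains i where "len (g \<otimes> s i) < len g"
proof -
  obtain w where w: "length w = len g" "word w = g" by (rule ex_reduced_word[OF assms(1)])
  then obtain i v where v: "w = i # v" using assms(2) by (cases w) auto
  then have "g \<otimes> s i = word v" using w by (auto simp: mult_s_s)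
  then have "len (g \<otimes> s i) < len g" using len_le[of v "g \<otimes> s i"] w v by simp
  then show thesis by (rule that)
qed

text \<open>The alternating products are indexed by their last factor, here \<open>s a\<close>.\<close>

fun alt :: "'k \<Rightarrow> 'k \<Rightarrow> nat \<Rightarrow> 'g" where
  "alt a b 0 = \<one>"
| "alt a b (Suc q) = alt b a q \<otimes> s a"

lemma alt_closed [simp]: "alt a b q \<in> carrier G"
  by (induction a b q rule: alt.induct) auto

lemma alt_Suc_left: "alt a b (Suc q) = s (if even q then a else b) \<otimes> alt a b q"
proof (induction q arbitrary: a b)
  case (Suc q)
  have "alt a b (Suc (Suc q)) = s (if even q then b else a) \<otimes> alt b a q \<otimes> s a"
    using Suc[of b a] by simp
  then show ?case by (simp add: m_assoc)
qed simp

lemma pow_mult_commute: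
  assumes "x \<in> carrier G" "y \<in> carrier G"
  shows "x \<otimes> (y \<otimes> x) [^] (q :: nat) \<otimes> y = (x \<otimes> y) [^] Suc q"
proof (induction q)
  case (Suc q)
  have "x \<otimes> (y \<otimes> x) [^] Suc q \<otimes> y = (x \<otimes> (y \<otimes> x) [^] q \<otimes> y) \<otimes> (x \<otimes> y)"
    using assms by (simp add: m_assoc)
  then show ?case using Suc by simp
qed (use assms in simp)

text \<open>As the generators are involutions, inverting an alternating word reverses it. This
  converts the relation on powers of \<open>s a \<otimes> s b\<close> into the equality of two
  alternating words.\<close>

lemma inv_alt_mult_alt: "inv (alt a b q) \<otimes> alt b a q = (s a \<otimes> s b) [^] q"
proof (induction q arbitrary: a b)
  case (Suc q)
  have "inv (alt a b (Suc q)) \<otimes> alt b a (Suc q) = s a \<otimes> (inv (alt b a q) \<otimes> alt a b q) \<otimes> s b"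
    by (simp add: inv_mult_group inv_s m_assoc)
  also have "\<dots> = (s a \<otimes> s b) [^] Suc q"
    unfolding Suc by (rule pow_mult_commute) simp_all
  finally show ?case .
qed simp

lemma alt_braid:
  assumes "a \<noteq> b"
  shows "alt a b (m a b) = alt b a (m a b)"
proof -
  have "inv (alt a b (m a b)) \<otimes> alt b a (m a b) = \<one>"
    unfolding inv_alt_mult_alt by (rule braid[OF assms])
  then have "inv (inv (alt a b (m a b))) = alt b a (m a b)"
    by (metis alt_closed inv_closed inv_equality inv_inv)
  then show ?thesis by simp
qed

lemma len_le_mult_alt:
  assumes "g \<in> carrier G"
  shows "len g \<le> len (g \<otimes> alt a b q) + q"
proof (induction q arbitrary: a b)
  case (Suc q)
  have "len g \<le> len (g \<otimes> alt b a q) + q" by (rule Suc)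
  also have "len (g \<otimes> alt b a q) \<le> Suc (len (g \<otimes> alt b a q \<otimes> s a))"
    using assms by (intro len_le_mult_s) simp
  finally show ?case using assms by (simp add: m_assoc)
qed (use assms in simp)

lemma \<rho>_linear: "g \<in> carrier G \<Longrightarrow> linear (\<rho> g)"
  using \<rho>_orthogonal orthogonal_transformation_linear by blast

text \<open>Tits's lemma: if \<open>g s\<^sub>i\<close> is not shorter than \<open>g\<close>, then \<open>g\<close> maps the simple root \<open>n\<^sub>i\<close> to a
  positive root. For \<open>g s\<^sub>t\<close> shorter than \<open>g\<close>, one strips letters \<open>t, i, t, \<dots>\<close> off the end of \<open>g\<close> as
  long as the length drops; the braid relation bounds the number \<open>q\<close> of letters by \<open>q < m i t\<close>, and
  in the plane of \<open>n\<^sub>i\<close> and \<open>n\<^sub>t\<close> the stripped letters send \<open>n\<^sub>i\<close> to a combination with coefficients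
  \<open>sin (j \<theta>)\<close>, which are nonnegative.\<close>

theorem root_positive:
  assumes p: "\<And>i. 0 < n i \<bullet> p"
    and "g \<in> carrier G" "len g \<le> len (g \<otimes> s i)"
  shows "0 < \<rho> g (n i) \<bullet> p"
  using assms(2,3)
proof (induction "len g" arbitrary: g i rule: less_induct)
  case less
  note g = \<open>g \<in> carrier G\<close>
  show ?case
  proof (cases "g = \<one>")
    case True
    have "\<rho> \<one> (n i) = n i"
    proof -
      have "\<rho> \<one> (\<rho> \<one> (n i)) = \<rho> \<one> (n i)" using \<rho>_mult[of \<one> \<one>] by (metis comp_apply l_one one_closed)
      then show ?thesis
        using orthogonal_transformation_inj[OF \<rho>_orthogonal[OF one_closed]] by (metis injD)
    qed
    then show ?thesis using p True by simp
  next
    case False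
    then obtain t where t: "len (g \<otimes> s t) < len g" using ex_descent g by blast
    then have "i \<noteq> t" using less.prems(2) by auto
    define \<theta> where "\<theta> = pi / real (m i t)"
    have m2: "2 \<le> m i t" by (rule m_ge) fact
    have \<theta>: "0 < \<theta>" "\<theta> * real (m i t) = pi" using m2 by (auto simp: \<theta>_def)
    have inn: "n i \<bullet> n t = - cos \<theta>" "n t \<bullet> n i = - cos \<theta>"
      using gram[OF \<open>i \<noteq> t\<close>] by (simp_all add: \<theta>_def inner_commute)
    define a where "a q = (if even q then i else t)" for q :: nat
    define b where "b q = (if even q then t else i)" for q :: nat
    have ab_Suc: "a (Suc q) = b q" "b (Suc q) = a q" for q by (simp_all add: a_def b_def)
    define h where "h q = g \<otimes> alt (a q) (b q) q" for q
    have h: "h q \<in> carrier G" for q using g by (simp add: h_def)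
    have h_Suc: "h (Suc q) = h q \<otimes> s (b q)" for q
      using g by (simp add: h_def ab_Suc m_assoc)
    have h_Suc': "h (Suc q) \<otimes> s (a (Suc q)) = h q" for q
      unfolding h_Suc ab_Suc by (rule mult_s_s[OF h])
    have len_h: "len g \<le> len (h q) + q" for q
      unfolding h_def by (rule len_le_mult_alt[OF g])
    \<comment> \<open>Each reflection advances the coefficients by the recurrence for
      \<open>sin (real q * \<theta>)\<close>. The factor \<open>sin \<theta>\<close> on the left
      avoids dividing the coefficients by it.\<close>
    have geom: "sin \<theta> *\<^sub>R \<rho> g (n i) =
        \<rho> (h q) (sin (real (Suc q) * \<theta>) *\<^sub>R n (a q) + sin (real q * \<theta>) *\<^sub>R n (b q))" for q
    proof (induction q)
      case 0
      then show ?case using g by (simp add: h_def a_def linear_cmul[OF \<rho>_linear])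
    next
      case (Suc q)
      have "\<rho> (h q) = \<rho> (h (Suc q)) \<circ> reflection (n (b q))"
        using \<rho>_mult[OF h s_closed, of "Suc q" "a (Suc q)"] unfolding h_Suc' by (simp add: ab_Suc \<rho>_s)
      moreover have "n (a q) \<bullet> n (b q) = - cos \<theta>" using inn by (simp add: a_def b_def)
      moreover have "n (b q) \<bullet> n (b q) = 1" using norm_n by (simp add: norm_eq_1)
      ultimately have "\<rho> (h q) (x *\<^sub>R n (a q) + y *\<^sub>R n (b q)) =
          \<rho> (h (Suc q)) ((2 * cos \<theta> * x - y) *\<^sub>R n (b q) + x *\<^sub>R n (a q))" for x y
      proof -
        have "reflection (n (b q)) (x *\<^sub>R n (a q) + y *\<^sub>R n (b q)) =
            (y - 2 * (y - x * cos \<theta>)) *\<^sub>R n (b q) + x *\<^sub>R n (a q)"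
        proof -
          have inner: "(x *\<^sub>R n (a q) + y *\<^sub>R n (b q)) \<bullet> n (b q) = y - x * cos \<theta>"
            by (simp add: inner_add_left \<open>n (a q) \<bullet> n (b q) = - cos \<theta>\<close> \<open>n (b q) \<bullet> n (b q) = 1\<close>)
          have "v + y *\<^sub>R w - z *\<^sub>R w = (y - z) *\<^sub>R w + v" for v w :: 'a and z
            by (simp add: scaleR_left_diff_distrib)
          then show ?thesis unfolding reflection_def inner .
        qed
        also have "y - 2 * (y - x * cos \<theta>) = 2 * cos \<theta> * x - y" by simp
        finally show ?thesis by (simp add: \<open>\<rho> (h q) = _\<close>)
      qed
      moreover have "2 * cos \<theta> * sin (real (Suc q) * \<theta>) - sin (real q * \<theta>) = sin (real (Suc (Suc q)) * \<theta>)"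
      proof -
        have 1: "real (Suc (Suc q)) * \<theta> = real (Suc q) * \<theta> + \<theta>" "real q * \<theta> = real (Suc q) * \<theta> - \<theta>"
          by (simp_all add: algebra_simps)
        show ?thesis unfolding 1 sin_add sin_diff by simp
      qed
      ultimately show ?case using Suc by (simp add: ab_Suc)
    qed
    have "\<exists>q. len (h (Suc q)) + Suc q \<noteq> len g" by (rule exI[of _ "len g"]) simp
    \<comment> \<open>The first \<open>q\<close> at which stripping one more letter fails to shorten
      the element. It exists because the length cannot drop more than \<open>len g\<close>
      times.\<close>
    moreover define q where "q = (LEAST q. len (h (Suc q)) + Suc q \<noteq> len g)"
    ultimately have q: "len (h (Suc q)) + Suc q \<noteq> len g" by (metis (lifting) LeastI_ex)
    have below: "len (h (Suc q')) + Suc q' = len g" if "q' < q" for q'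
      using not_less_Least[of q' "\<lambda>q. len (h (Suc q)) + Suc q \<noteq> len g"] that unfolding q_def by blast
    have "len (h (Suc 0)) + Suc 0 = len g"
    proof -
      have "h (Suc 0) = g \<otimes> s t" using g by (simp add: h_def a_def b_def)
      then show ?thesis using t len_le_mult_s[OF g, of t] by simp
    qed
    then have "q \<noteq> 0" using q by (intro notI) simp
    then obtain r where r: "q = Suc r" using not0_implies_Suc by blast
    have len_q: "len (h q) + q = len g" using below[of r] r by simp
    \<comment> \<open>Otherwise \<open>m i t\<close> letters could be stripped; the braid relation
      rewrites them so that \<open>i\<close> is stripped first, and \<open>g \<otimes> s i\<close>
      would be shorter than \<open>g\<close>.\<close>
    have "q < m i t"
    proof (rule ccontr)
      assume "\<not> q < m i t"
      moreover obtain k where k: "m i t = Suc k" using m2 by (cases "m i t") auto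
      ultimately have eq: "len (h (Suc k)) + Suc k = len g" using below[of k] by simp
      have "alt (a (Suc k)) (b (Suc k)) (Suc k) = alt (b (Suc k)) (a (Suc k)) (Suc k)"
        using alt_braid[OF \<open>i \<noteq> t\<close>] k by (simp add: a_def b_def)
      also have "\<dots> = s i \<otimes> alt (a k) (b k) k"
        unfolding ab_Suc alt_Suc_left by (simp add: a_def b_def)
      finally have "h (Suc k) = (g \<otimes> s i) \<otimes> alt (a k) (b k) k"
        using g by (simp add: h_def m_assoc del: alt.simps)
      then have "len (g \<otimes> s i) \<le> len (h (Suc k)) + k"
        using len_le_mult_alt[of "g \<otimes> s i"] g by simp
      then show False using eq less.prems(2) by simp
    qed
    have lt: "len (h q) < len g" using len_q \<open>q \<noteq> 0\<close> by simp
    \<comment> \<open>Neither letter is a descent of \<open>h q\<close>: \<open>a q\<close> was the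
      last one stripped, so putting it back lengthens, and \<open>b q\<close> is the one at which
      stripping fails.\<close>
    have "len (h q) \<le> len (h q \<otimes> s (a q))"
      using len_h[of r] len_q h_Suc'[of r] by (simp add: r)
    then have pos_a: "0 < \<rho> (h q) (n (a q)) \<bullet> p" by (rule less.hyps[OF lt h])
    have "len (h q) \<le> len (h q \<otimes> s (b q))"
      using len_h[of "Suc q"] len_q q by (simp add: h_Suc[symmetric])
    then have pos_b: "0 < \<rho> (h q) (n (b q)) \<bullet> p" by (rule less.hyps[OF lt h])
    have lin: "linear (\<rho> (h q))" by (rule \<rho>_linear[OF h])
    have "sin \<theta> * (\<rho> g (n i) \<bullet> p) = sin \<theta> *\<^sub>R \<rho> g (n i) \<bullet> p" by simp
    also have "\<dots> = sin (real (Suc q) * \<theta>) * (\<rho> (h q) (n (a q)) \<bullet> p) + sin (real q * \<theta>) * (\<rho> (h q) (n (b q)) \<bullet> p)"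
      unfolding geom[of q] by (simp add: linear_add[OF lin] linear_cmul[OF lin] inner_add_left)
    also have "\<dots> > 0"
    \<comment> \<open>The first coefficient may vanish, namely when \<open>Suc q = m i t\<close>;
      strictness comes from the second, since \<open>0 < q < m i t\<close>.\<close>
    proof (rule add_nonneg_pos)
      have "real (Suc q) * \<theta> \<le> real (m i t) * \<theta>"
        using \<open>q < m i t\<close> \<theta>(1) by (intro mult_right_mono) auto
      then have "0 \<le> sin (real (Suc q) * \<theta>)" using \<theta> by (intro sin_ge_zero) (auto simp: mult.commute)
      then show "0 \<le> sin (real (Suc q) * \<theta>) * (\<rho> (h q) (n (a q)) \<bullet> p)" using pos_a by simp
      have "real q * \<theta> < real (m i t) * \<theta>"
        using \<open>q < m i t\<close> \<theta>(1) by (intro mult_strict_right_mono) auto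
      then have "0 < sin (real q * \<theta>)" using \<theta> \<open>q \<noteq> 0\<close> by (intro sin_gt_zero) (auto simp: mult.commute)
      then show "0 < sin (real q * \<theta>) * (\<rho> (h q) (n (b q)) \<bullet> p)" using pos_b by simp
    qed
    finally have "0 < sin \<theta> * (\<rho> g (n i) \<bullet> p)" .
    moreover have "0 < sin \<theta>"
    proof (rule sin_gt_zero)
      have "\<theta> * 1 < \<theta> * real (m i t)" using \<theta>(1) m2 by (intro mult_strict_left_mono) auto
      then show "\<theta> < pi" using \<theta> by simp
    qed (rule \<theta>)
    ultimately show ?thesis by (simp add: zero_less_mult_iff)
  qed
qed

text \<open>A nontrivial \<open>g\<close> has a descent \<open>i\<close>, and then it sends
  \<open>n i\<close> to a negative root. If \<open>g\<close> fixed \<open>p\<close>, orthogonality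
  would give \<open>\<rho> g (n i)\<close> the same positive inner product with \<open>p\<close> as
  \<open>n i\<close> has.\<close>

theorem stabilizer_trivial:
  assumes p: "\<And>i. 0 < n i \<bullet> p" and g: "g \<in> carrier G" and stable: "\<rho> g p = p"
  shows "g = \<one>"
proof (rule ccontr)
  assume "g \<noteq> \<one>"
  then obtain i where i: "len (g \<otimes> s i) < len g" using ex_descent g by blast
  then have "len (g \<otimes> s i) \<le> len (g \<otimes> s i \<otimes> s i)" using g by (simp add: mult_s_s)
  then have "0 < \<rho> (g \<otimes> s i) (n i) \<bullet> p" using g by (intro root_positive[OF p]) simp_all
  also have "\<rho> (g \<otimes> s i) (n i) = \<rho> g (- n i)"
    using norm_n[of i] g by (simp add: \<rho>_mult \<rho>_s reflection_def norm_eq_1 algebra_simps scaleR_2)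
  also have "\<dots> = - \<rho> g (n i)" by (rule linear_neg[OF \<rho>_linear[OF g]])
  also have "- \<rho> g (n i) \<bullet> p = - (\<rho> g (n i) \<bullet> \<rho> g p)" by (simp add: stable)
  also have "\<dots> = - (n i \<bullet> p)" using \<rho>_orthogonal[OF g] by (simp add: orthogonal_transformation_def)
  finally show False using p[of i] by simp
qed

theorem orbit_map_inj:
  assumes p: "\<And>i. 0 < n i \<bullet> p"
  shows "inj_on (\<lambda>g. \<rho> g p) (carrier G)"
proof (rule inj_onI)
  fix g h assume g: "g \<in> carrier G" and h: "h \<in> carrier G" and eq: "\<rho> g p = \<rho> h p"
  have "\<rho> h (\<rho> (inv h \<otimes> g) p) = \<rho> h p"
    using \<rho>_mult[of h "inv h \<otimes> g"] g h eq by (simp add: m_assoc[symmetric])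
  then have "\<rho> (inv h \<otimes> g) p = p"
    using orthogonal_transformation_inj[OF \<rho>_orthogonal[OF h]] by (metis injD)
  then have "inv h \<otimes> g = \<one>" using g h by (intro stabilizer_trivial[OF p]) simp_all
  then show "g = h" using g h by (metis inv_equality inv_inv inv_closed)
qed

section \<open>Averages over neighbours and edge lengths in an orbit\<close>

lemma weighted_reflections_eigenvector:
  assumes "g \<in> carrier G" "(\<Sum>j\<in>UNIV. x j) = 1" "(\<Sum>j\<in>UNIV. (x j * (n j \<bullet> p)) *\<^sub>R n j) = \<nu> *\<^sub>R p"
  shows "(\<Sum>j\<in>UNIV. x j *\<^sub>R \<rho> (g \<otimes> s j) p) = (1 - 2 * \<nu>) *\<^sub>R \<rho> g p"
proof -
  have "(\<Sum>j\<in>UNIV. x j *\<^sub>R reflection (n j) p) =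
      (\<Sum>j\<in>UNIV. x j *\<^sub>R p - 2 *\<^sub>R ((x j * (n j \<bullet> p)) *\<^sub>R n j))"
    by (rule sum.cong) (simp_all add: reflection_def scaleR_diff_right inner_commute mult_ac)
  also have "\<dots> = (\<Sum>j\<in>UNIV. x j) *\<^sub>R p - 2 *\<^sub>R (\<Sum>j\<in>UNIV. (x j * (n j \<bullet> p)) *\<^sub>R n j)"
    by (simp only: sum_subtractf scaleR_sum_left scaleR_sum_right)
  also have "\<dots> = (1 - 2 * \<nu>) *\<^sub>R p" by (simp add: assms scaleR_left_diff_distrib)
  finally have "\<rho> g (\<Sum>j\<in>UNIV. x j *\<^sub>R reflection (n j) p) = (1 - 2 * \<nu>) *\<^sub>R \<rho> g p"
    by (simp add: linear_cmul[OF \<rho>_linear[OF assms(1)]])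
  then show ?thesis
    using assms(1) by (simp add: \<rho>_mult \<rho>_s linear_sum[OF \<rho>_linear] linear_cmul[OF \<rho>_linear])
qed

lemma dist_edge:
  assumes "{g, g'} \<in> cayley_edge_class G s j"
  shows "dist (\<rho> g p) (\<rho> g' p) = norm (p - reflection (n j) p)"
proof -
  obtain h where h: "h \<in> carrier G" "{g, g'} = {h, h \<otimes> s j}"
    using assms by (auto simp: cayley_edge_class_def)
  have "dist (\<rho> h p) (\<rho> (h \<otimes> s j) p) = norm (\<rho> h (p - reflection (n j) p))"
    using h(1) by (simp add: dist_norm \<rho>_mult \<rho>_s linear_diff[OF \<rho>_linear])
  also have "\<dots> = norm (p - reflection (n j) p)"
    using \<rho>_orthogonal[OF h(1)] by (rule orthogonal_transformation_norm)
  finally show ?thesis using h(2) by (auto simp: doubleton_eq_iff dist_commute)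
qed

lemma norm_diff_reflection: "norm (p - reflection (n j) p) = 2 * \<bar>n j \<bullet> p\<bar>"
  by (simp add: reflection_def norm_n inner_commute abs_mult)

end

locale finite_coxeter_representation = coxeter_representation G s m n \<rho>
  for G :: "('g, 'b) monoid_scheme" (structure)
    and s :: "'k \<Rightarrow> 'g" and m :: "'k \<Rightarrow> 'k \<Rightarrow> nat"
    and n :: "'k \<Rightarrow> 'a::euclidean_space" and \<rho> :: "'g \<Rightarrow> 'a \<Rightarrow> 'a" +
  assumes finite_carrier: "finite (carrier G)"
    and separating: "(\<And>i. n i \<bullet> w = 0) \<Longrightarrow> w = 0"
    and connected: "(i, j) \<in> {(a, b). n a \<bullet> n b < 0}\<^sup>*"
begin

text \<open>The frame operator of the orbit of \<open>p\<close>; in the standard basis its entries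
  are the inner products of the coordinate functions on the group.\<close>

definition orbit_gram :: "'a \<Rightarrow> 'a \<Rightarrow> 'a" where
  "orbit_gram p v = (\<Sum>g\<in>carrier G. (\<rho> g p \<bullet> v) *\<^sub>R \<rho> g p)"

lemma orbit_gram_inner: "orbit_gram p v \<bullet> w = (\<Sum>g\<in>carrier G. (\<rho> g p \<bullet> v) * (\<rho> g p \<bullet> w))"
  by (simp add: orbit_gram_def inner_sum_left)

lemma orbit_gram_sym: "orbit_gram p v \<bullet> w = v \<bullet> orbit_gram p w"
  unfolding inner_commute[of v] orbit_gram_inner by (simp add: mult.commute)

lemma orbit_gram_commute:
  assumes "h \<in> carrier G"
  shows "\<rho> h (orbit_gram p v) = orbit_gram p (\<rho> h v)"
proof -
  have bij: "bij_betw (\<lambda>g. h \<otimes> g) (carrier G) (carrier G)"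
    by (rule bij_betwI[of _ _ _ "\<lambda>g. inv h \<otimes> g"]) (use assms in \<open>auto simp: m_assoc[symmetric]\<close>)
  have "\<rho> h (orbit_gram p v) = (\<Sum>g\<in>carrier G. (\<rho> g p \<bullet> v) *\<^sub>R \<rho> h (\<rho> g p))"
    by (simp add: orbit_gram_def linear_sum[OF \<rho>_linear[OF assms]] linear_cmul[OF \<rho>_linear[OF assms]])
  also have "\<dots> = (\<Sum>g\<in>carrier G. (\<rho> (h \<otimes> g) p \<bullet> \<rho> h v) *\<^sub>R \<rho> (h \<otimes> g) p)"
    using \<rho>_orthogonal[OF assms] assms
    by (intro sum.cong) (simp_all add: \<rho>_mult orthogonal_transformation_def)
  also have "\<dots> = orbit_gram p (\<rho> h v)"
    unfolding orbit_gram_def by (rule sum.reindex_bij_betw[OF bij])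
  finally show ?thesis .
qed

text \<open>Schur's lemma in elementary form: an operator commuting with the reflections preserves their
  \<open>-1\<close>-eigenspaces, hence has the simple roots as eigenvectors; by symmetry, adjacent roots in the
  Coxeter graph have the same eigenvalue.\<close>

lemma orbit_gram_scalar:
  obtains c where "\<And>v. orbit_gram p v = c *\<^sub>R v"
proof -
  define c where "c j = orbit_gram p (n j) \<bullet> n j" for j
  have nn: "n j \<bullet> n j = 1" for j using norm_n by (simp add: norm_eq_1)
  have eig: "orbit_gram p (n j) = c j *\<^sub>R n j" for j
  proof -
    have "orbit_gram p (- n j) = - orbit_gram p (n j)"
      by (simp add: orbit_gram_def sum_negf)
    moreover have "reflection (n j) (n j) = - n j" by (simp add: reflection_def nn scaleR_2)
    ultimately have "reflection (n j) (orbit_gram p (n j)) = - orbit_gram p (n j)"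
      using orbit_gram_commute[OF s_closed, of j p "n j"] by (simp add: \<rho>_s)
    then have "2 *\<^sub>R orbit_gram p (n j) = (2 * c j) *\<^sub>R n j"
      by (simp add: reflection_def c_def scaleR_2 algebra_simps)
    then have "2 *\<^sub>R orbit_gram p (n j) = 2 *\<^sub>R (c j *\<^sub>R n j)" by simp
    then show ?thesis by (simp only: scaleR_cancel_left) simp
  qed
  have adj: "c i = c j" if "n i \<bullet> n j < 0" for i j
    using orbit_gram_sym[of p "n i" "n j"] that by (simp add: eig)
  have "c i = c j" for i j
    using connected[of i j] by (induction rule: rtrancl_induct) (auto dest: adj)
  \<comment> \<open>All \<open>c j\<close> are equal, so \<open>undefined\<close> serves as an
    arbitrary index.\<close>
  then have eig': "orbit_gram p (n j) = c undefined *\<^sub>R n j" for j using eig by metis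
  have "orbit_gram p v = c undefined *\<^sub>R v" for v
  proof -
    have "orbit_gram p v - c undefined *\<^sub>R v = 0"
      by (rule separating)
        (simp add: inner_diff_right orbit_gram_sym[symmetric] eig')
    then show ?thesis by simp
  qed
  then show thesis by (rule that)
qed

text \<open>The scalar of the frame operator is found from its trace: every orbit point contributes
  its squared norm, which equals \<open>p \<bullet> p\<close>.\<close>

lemma orbit_orthogonality:
  "(\<Sum>g\<in>carrier G. (\<rho> g p \<bullet> v) * (\<rho> g p \<bullet> w)) = real (order G) / real DIM('a) * (p \<bullet> p) * (v \<bullet> w)"
proof -
  obtain c where c: "\<And>v. orbit_gram p v = c *\<^sub>R v" by (rule orbit_gram_scalar) blast
  have "c * real DIM('a) = (\<Sum>b\<in>Basis. orbit_gram p b \<bullet> b)" by (simp add: c)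
  also have "\<dots> = (\<Sum>g\<in>carrier G. \<Sum>b\<in>Basis. (\<rho> g p \<bullet> b) * (\<rho> g p \<bullet> b))"
    unfolding orbit_gram_inner by (rule sum.swap)
  also have "\<dots> = (\<Sum>g\<in>carrier G. \<rho> g p \<bullet> \<rho> g p)"
    by (simp add: euclidean_inner[symmetric])
  also have "\<dots> = (\<Sum>g\<in>carrier G. p \<bullet> p)"
    using \<rho>_orthogonal by (intro sum.cong) (auto simp: orthogonal_transformation_def)
  also have "\<dots> = real (order G) * (p \<bullet> p)" by (simp add: order_def)
  finally have "c = real (order G) / real DIM('a) * (p \<bullet> p)" by (simp add: field_simps)
  then show ?thesis
    using orbit_gram_inner[of p v w] by (simp add: c)
qed

end

section \<open>The geometric realisation\<close>

lemma coxeter_representationI: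
  assumes "coxeter_group G s m" "simple_roots m n" "geometric_realisation G s n \<rho>"
  shows "coxeter_representation G s m n \<rho>"
proof -
  have pres: "has_presentation G s (coxeter_relators m)" and cox: "coxeter_matrix m"
    using assms(1) by (auto simp: coxeter_group_def)
  interpret group G using pres by (simp add: has_presentation_def)
  have s: "s i \<in> carrier G" for i using pres by (auto simp: has_presentation_def)
  have rel: "eval_word G s r = \<one>\<^bsub>G\<^esub>" if "r \<in> coxeter_relators m" for r
  proof -
    have "pres_eq (coxeter_relators m) r []" using pres_relator[OF that, of "[]" "[]"] by simp
    then have "eval_word G s r = eval_word G s []" using pres by (simp add: has_presentation_def)
    then show ?thesis by (simp add: eval_word_def)
  qed
  show ?thesis
  proof unfold_locales
    fix i j
    show "s i \<in> carrier G" by (rule s)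
    show "s i \<otimes>\<^bsub>G\<^esub> s i = \<one>\<^bsub>G\<^esub>"
      using rel[of "[(i, True), (i, True)]"] s by (auto simp: coxeter_relators_def eval_word_def eval_letter_def)
    show "generate G (range s) = carrier G" using pres by (simp add: has_presentation_def)
    show "norm (n i) = 1" using assms(2) by (simp add: simple_roots_def)
    show "\<rho> (s i) = reflection (n i)" using assms(3) by (simp add: geometric_realisation_def)
    show "\<rho> (x \<otimes>\<^bsub>G\<^esub> y) = \<rho> x \<circ> \<rho> y" if "x \<in> carrier G" "y \<in> carrier G" for x y
      using assms(3) that by (auto simp: geometric_realisation_def hom_def orthogonal_group_def)
    show "orthogonal_transformation (\<rho> x)" if "x \<in> carrier G" for x
      using assms(3) that by (auto simp: geometric_realisation_def hom_def orthogonal_group_def)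
    assume "i \<noteq> j"
    then show "2 \<le> m i j" "n i \<bullet> n j = - cos (pi / real (m i j))"
      using cox assms(2) by (simp_all add: coxeter_matrix_def simple_roots_def)
    have "eval_word G s (concat (replicate q [(i, True), (j, True)])) = (s i \<otimes>\<^bsub>G\<^esub> s j) [^]\<^bsub>G\<^esub> q" for q
    proof (induction q)
      case (Suc q)
      have "eval_word G s (concat (replicate (Suc q) [(i, True), (j, True)])) =
          (s i \<otimes>\<^bsub>G\<^esub> s j) \<otimes>\<^bsub>G\<^esub> (s i \<otimes>\<^bsub>G\<^esub> s j) [^]\<^bsub>G\<^esub> q"
        using Suc s by (simp add: eval_word_def eval_letter_def m_assoc)
      also have "\<dots> = (s i \<otimes>\<^bsub>G\<^esub> s j) [^]\<^bsub>G\<^esub> Suc q"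
        by (rule nat_pow_Suc2[symmetric]) (use s in simp)
      finally show ?case .
    qed (simp add: eval_word_def)
    then show "(s i \<otimes>\<^bsub>G\<^esub> s j) [^]\<^bsub>G\<^esub> m i j = \<one>\<^bsub>G\<^esub>"
      using rel[of "concat (replicate (m i j) [(i, True), (j, True)])"] \<open>i \<noteq> j\<close>
      by (auto simp: coxeter_relators_def)
  qed
qed

lemma root_det_separating:
  fixes n :: "'k::finite \<Rightarrow> real ^ 'k"
  assumes "root_det n \<noteq> 0" "\<And>i. n i \<bullet> w = 0"
  shows "w = 0"
proof -
  define A :: "real ^ 'k ^ 'k" where "A = (\<chi> i. n i)"
  have "transpose A = (\<chi> i j. n j $ i)" by (simp add: A_def transpose_def vec_eq_iff)
  then have "det A \<noteq> 0" using assms(1) by (metis det_transpose root_det_def)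
  then obtain B where "B ** A = mat 1" by (metis invertible_def invertible_det_nz)
  moreover have "A *v w = 0"
    using assms(2) by (simp add: A_def vec_eq_iff matrix_vector_mult_def inner_vec_def)
  ultimately show ?thesis by (metis matrix_vector_mul_assoc matrix_vector_mul_lid matrix_vector_mult_0_right)
qed

lemma roots_obtuse_connected:
  assumes "coxeter_matrix m" "coxeter_irreducible m" "simple_roots m n"
  shows "i \<noteq> j \<Longrightarrow> n i \<bullet> n j \<le> 0" "(i, j) \<in> {(a, b). n a \<bullet> n b < 0}\<^sup>*"
proof -
  have gram: "n a \<bullet> n b = - cos (pi / real (m a b))" "2 \<le> m a b" if "a \<noteq> b" for a b
    using assms(1,3) that by (simp_all add: coxeter_matrix_def simple_roots_def)
  show "n i \<bullet> n j \<le> 0" if "i \<noteq> j"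
  proof -
    have "pi / real (m i j) \<le> pi / 2" using gram(2)[OF that] by (intro divide_left_mono) auto
    moreover have "0 \<le> pi / real (m i j)" by simp
    ultimately have "0 \<le> cos (pi / real (m i j))" by (intro cos_ge_zero) linarith+
    then show ?thesis using gram(1)[OF that] by simp
  qed
  have "n a \<bullet> n b < 0" if "a \<noteq> b" "3 \<le> m a b" for a b
  proof -
    have "pi / real (m a b) \<le> pi / 3" using that(2) by (intro divide_left_mono) auto
    moreover have "0 < pi / real (m a b)" using that(2) by simp
    ultimately have "0 < cos (pi / real (m a b))" by (intro cos_gt_zero) (use pi_gt_zero in linarith)+
    then show ?thesis using gram(1)[OF that(1)] by simp
  qed
  then have "{(a, b). a \<noteq> b \<and> 3 \<le> m a b} \<subseteq> {(a, b). n a \<bullet> n b < 0}" by auto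
  then show "(i, j) \<in> {(a, b). n a \<bullet> n b < 0}\<^sup>*"
    using assms(2) rtrancl_mono unfolding coxeter_irreducible_def by blast
qed

lemma chamber_eq:
  fixes n :: "'k::{finite, linorder} \<Rightarrow> real ^ ('k::{finite, linorder})"
  assumes "0 < root_det n"
  shows "chamber n = {p. \<forall>i. 0 < n i \<bullet> p}"
proof (intro equalityI subsetI)
  fix p assume "p \<in> chamber n"
  then obtain \<alpha> where "p = (\<Sum>j\<in>UNIV. \<alpha> j *\<^sub>R dual_vec n j)" "\<forall>j. 0 < \<alpha> j"
    by (auto simp: chamber_def)
  then show "p \<in> {p. \<forall>i. 0 < n i \<bullet> p}"
    using assms by (simp add: inner_sum_right inner_dual_vec if_distrib cong: if_cong)
next
  fix p assume p: "p \<in> {p. \<forall>i. 0 < n i \<bullet> p}"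
  define \<alpha> where "\<alpha> j = (n j \<bullet> p) / root_det n" for j
  have "p - (\<Sum>j\<in>UNIV. \<alpha> j *\<^sub>R dual_vec n j) = 0"
    by (rule root_det_separating[of n])
      (use assms in \<open>simp_all add: inner_diff_right inner_sum_right inner_dual_vec \<alpha>_def if_distrib cong: if_cong\<close>)
  then show "p \<in> chamber n"
    unfolding chamber_def using p assms by (intro CollectI exI[of _ \<alpha>]) (simp add: \<alpha>_def)
qed

theorem corollary1p7:
  fixes G :: "('g, 'b) monoid_scheme"
    and s :: "'k::{finite, linorder} \<Rightarrow> 'g"
    and m :: "'k \<Rightarrow> 'k \<Rightarrow> nat"
    and n :: "'k \<Rightarrow> real ^ ('k::{finite, linorder})"
    and \<rho> :: "'g \<Rightarrow> real ^ ('k::{finite, linorder}) \<Rightarrow> real ^ ('k::{finite, linorder})"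
  assumes "2 \<le> CARD('k)"
    and "coxeter_group G s m"
    and "finite (carrier G)"
    and "coxeter_irreducible m"
    and "simple_roots m n"
    and "root_det n > 0"
    and "geometric_realisation G s n \<rho>"
  shows "\<exists>\<Psi>\<^sub>\<Delta> \<Psi>\<^sub>l.
    smooth_map_on (chamber0 n) \<Psi>\<^sub>\<Delta> \<and>
    bij_betw \<Psi>\<^sub>\<Delta> (chamber0 n) int_weights \<and>
    smooth_map_on (chamber0 n) \<Psi>\<^sub>l \<and>
    \<Psi>\<^sub>l ` chamber0 n \<subseteq> {0<..<1} \<and>
    analytic_map_on int_weights (\<Psi>\<^sub>l \<circ> inv_into (chamber0 n) \<Psi>\<^sub>\<Delta>) \<and>
    (\<forall>(\<alpha> :: 'k \<Rightarrow> real) p. p = (\<Sum>j\<in>UNIV. \<alpha> j *\<^sub>R dual_vec n j) \<and> p \<in> chamber0 n \<longrightarrow>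
      (let \<phi> = (\<lambda>i \<gamma>. \<rho> \<gamma> p $ i);
           \<Phi> = (\<lambda>\<gamma>. \<chi> i. \<phi> i \<gamma>)
       in (\<forall>i. eigenfunction G (markov_op G s (\<Psi>\<^sub>\<Delta> p)) (\<Psi>\<^sub>l p) (\<phi> i)) \<and>
          (\<forall>i j. i \<noteq> j \<longrightarrow> fun_inner G (\<phi> i) (\<phi> j) = 0) \<and>
          (\<forall>i. (fun_norm G (\<phi> i))\<^sup>2 = real (order G) / real CARD('k)) \<and>
          (\<forall>\<gamma>\<in>carrier G. \<Phi> \<gamma> = \<rho> \<gamma> p) \<and>
          \<Phi> ` carrier G \<subseteq> sphere 0 1 \<and>
          inj_on \<Phi> (carrier G) \<and>
          (\<forall>j \<gamma> \<gamma>'. {\<gamma>, \<gamma>'} \<in> cayley_edge_class G s j \<longrightarrow>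
             dist (\<Phi> \<gamma>) (\<Phi> \<gamma>') = norm (p - reflection (n j) p)) \<and>
          (\<forall>j. norm (p - reflection (n j) p) = 2 * \<alpha> j * root_det n)))"
proof -
  define V where "V = root_det n"
  have V: "0 < V" using assms(6) by (simp add: V_def)
  have cox: "coxeter_matrix m" using assms(2) by (simp add: coxeter_group_def)
  note separating = root_det_separating[of n, OF less_imp_neq[OF assms(6), symmetric]]
  note roots = roots_obtuse_connected[OF cox assms(4,5)]
  interpret W: finite_coxeter_representation G s m n \<rho>
  proof -
    interpret coxeter_representation G s m n \<rho> by (rule coxeter_representationI[OF assms(2,5,7)])
    show "finite_coxeter_representation G s m n \<rho>"
      by unfold_locales (use assms(3) separating roots(2) in blast)+
  qed
  interpret S: simple_system n "\<lambda>j. (1 / V) *\<^sub>R dual_vec n j"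
    by unfold_locales
      (use W.norm_n V separating roots assms(1) in \<open>simp_all add: inner_dual_vec flip: V_def\<close>)
  have chamber0: "chamber0 n = S.open_chamber \<inter> sphere 0 1"
    unfolding chamber0_def chamber_eq[OF assms(6)] S.open_chamber_def ..
  define \<Psi> where "\<Psi> = S.eigweights"
  define \<Lambda> where "\<Lambda> p = 1 - 2 * S.eigval p" for p
  have bij: "bij_betw \<Psi> (chamber0 n) int_weights"
    unfolding chamber0 \<Psi>_def by (rule S.bij_betw_eigweights)
  have smooth_\<Psi>: "smooth_map_on (chamber0 n) \<Psi>"
    unfolding \<Psi>_def chamber0
    by (rule smooth_map_on_open_subset[OF S.open_open_chamber _ S.Ck_on_eigweights]) simp
  have "Ck_on r S.open_chamber (\<lambda>p. 1 + (- 2) * S.eigval p)" for r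
    by (rule Ck_on_add[OF S.open_open_chamber Ck_on_const[OF S.open_open_chamber]
          Ck_on_mult[OF S.open_open_chamber Ck_on_const[OF S.open_open_chamber] S.Ck_on_eigval]])
  then have smooth_\<Lambda>: "smooth_map_on (chamber0 n) \<Lambda>"
    unfolding chamber0
    by (intro smooth_map_on_open_subset[OF S.open_open_chamber]) (simp_all add: \<Lambda>_def[abs_def])
  have range_\<Lambda>: "\<Lambda> ` chamber0 n \<subseteq> {0<..<1}"
    using S.eigval_bounds by (force simp: \<Lambda>_def chamber0)
  have analytic: "analytic_map_on int_weights (\<Lambda> \<circ> inv_into (chamber0 n) \<Psi>)"
    unfolding analytic_map_on_def
  proof (intro ballI exI conjI)
    fix a :: "real ^ ('k::{finite, linorder})" assume a: "a \<in> int_weights"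
    define U where "U = {x :: real ^ ('k::{finite, linorder}). \<forall>i. 0 < x $ i}"
    have "U = (\<Inter>i. {x. 0 < x $ i})" by (auto simp: U_def)
    then show "open U" by (simp add: open_INT open_halfspace_component_gt_cart)
    show "a \<in> U" using a by (simp add: U_def int_weights_def)
    show "real_analytic_at (\<lambda>x. 1 - 2 * S.perron x) x" if "x \<in> U" for x
      using that by (intro S.real_analytic_at_perron) (simp add: U_def)
    show "1 - 2 * S.perron x = (\<Lambda> \<circ> inv_into (chamber0 n) \<Psi>) x" if x: "x \<in> int_weights \<inter> U" for x
    proof -
      define p where "p = inv_into (chamber0 n) \<Psi> x"
      have "x \<in> \<Psi> ` chamber0 n" using bij x by (simp add: bij_betw_def)
      then have p: "p \<in> chamber0 n" "S.eigweights p = x"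
        unfolding p_def \<Psi>_def[symmetric] by (rule inv_into_into, rule f_inv_into_f)
      have "p \<in> S.open_chamber" using p(1) by (simp add: chamber0)
      then have "S.perron x = S.eigval p"
        using S.perron_eqI S.eigweights_eigen p(2) by blast
      then show ?thesis by (simp add: \<Lambda>_def p_def)
    qed
  qed
  have evaluation: "let \<phi> = (\<lambda>i \<gamma>. \<rho> \<gamma> p $ i);
           \<Phi> = (\<lambda>\<gamma>. \<chi> i. \<phi> i \<gamma>)
       in (\<forall>i. eigenfunction G (markov_op G s (\<Psi> p)) (\<Lambda> p) (\<phi> i)) \<and>
          (\<forall>i j. i \<noteq> j \<longrightarrow> fun_inner G (\<phi> i) (\<phi> j) = 0) \<and>
          (\<forall>i. (fun_norm G (\<phi> i))\<^sup>2 = real (order G) / real CARD('k)) \<and>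
          (\<forall>\<gamma>\<in>carrier G. \<Phi> \<gamma> = \<rho> \<gamma> p) \<and>
          \<Phi> ` carrier G \<subseteq> sphere 0 1 \<and>
          inj_on \<Phi> (carrier G) \<and>
          (\<forall>j \<gamma> \<gamma>'. {\<gamma>, \<gamma>'} \<in> cayley_edge_class G s j \<longrightarrow>
             dist (\<Phi> \<gamma>) (\<Phi> \<gamma>') = norm (p - reflection (n j) p)) \<and>
          (\<forall>j. norm (p - reflection (n j) p) = 2 * \<alpha> j * root_det n)"
    if p: "p = (\<Sum>j\<in>UNIV. \<alpha> j *\<^sub>R dual_vec n j)" "p \<in> chamber0 n" for \<alpha> p
  proof -
    have chamber: "p \<in> S.open_chamber" and norm: "norm p = 1" using p(2) by (simp_all add: chamber0)
    have np: "0 < n j \<bullet> p" for j using chamber by (rule S.open_chamberD)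
    have \<alpha>: "n j \<bullet> p = \<alpha> j * root_det n" for j
      unfolding p(1) by (simp add: inner_sum_right inner_dual_vec if_distrib cong: if_cong)
    have pp: "p \<bullet> p = 1" using norm by (simp add: norm_eq_1)
    \<comment> \<open>The coordinates are inner products with the \<open>axis\<close> vectors, so
      orthogonality and norms are the two cases of one formula.\<close>
    have inner: "fun_inner G (\<lambda>\<gamma>. \<rho> \<gamma> p $ i) (\<lambda>\<gamma>. \<rho> \<gamma> p $ j) =
        (if i = j then real (order G) / real CARD('k) else 0)" for i j
      using W.orbit_orthogonality[of p "axis i 1" "axis j 1"]
      by (simp add: fun_inner_def inner_axis pp) (simp add: axis_def)
    have order: "0 < real (order G)"
      using W.order_gt_0_iff_finite assms(3) by simp
    have "eigenfunction G (markov_op G s (\<Psi> p)) (\<Lambda> p) (\<lambda>\<gamma>. \<rho> \<gamma> p $ i)" for i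
      unfolding eigenfunction_def
    proof
      \<comment> \<open>A coordinate function vanishing on the group would have norm zero, contrary
        to the norm formula.\<close>
      show "\<exists>\<gamma>\<in>carrier G. \<rho> \<gamma> p $ i \<noteq> 0"
      proof (rule ccontr)
        assume "\<not> ?thesis"
        then have "fun_inner G (\<lambda>\<gamma>. \<rho> \<gamma> p $ i) (\<lambda>\<gamma>. \<rho> \<gamma> p $ i) = 0"
          unfolding fun_inner_def by (intro sum.neutral) simp
        then show False using inner[of i i] order by simp
      qed
      show "\<forall>\<gamma>\<in>carrier G. markov_op G s (\<Psi> p) (\<lambda>\<gamma>. \<rho> \<gamma> p $ i) \<gamma> = \<Lambda> p * \<rho> \<gamma> p $ i"
      proof
        fix \<gamma> assume \<gamma>: "\<gamma> \<in> carrier G"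
        have "(\<Sum>j\<in>UNIV. \<Psi> p $ j) = 1"
          using S.eigweights_in[OF chamber] by (simp add: \<Psi>_def int_weights_def weights_def)
        from W.weighted_reflections_eigenvector[OF \<gamma> this, of p "S.eigval p"]
        have "(\<Sum>j\<in>UNIV. \<Psi> p $ j *\<^sub>R \<rho> (\<gamma> \<otimes>\<^bsub>G\<^esub> s j) p) = \<Lambda> p *\<^sub>R \<rho> \<gamma> p"
          using S.eigweights_eigen[OF chamber] by (simp add: S.weighted_gram_def \<Psi>_def \<Lambda>_def)
        then have "(\<Sum>j\<in>UNIV. \<Psi> p $ j *\<^sub>R \<rho> (\<gamma> \<otimes>\<^bsub>G\<^esub> s j) p) $ i = (\<Lambda> p *\<^sub>R \<rho> \<gamma> p) $ i" by simp
        then show "markov_op G s (\<Psi> p) (\<lambda>\<gamma>. \<rho> \<gamma> p $ i) \<gamma> = \<Lambda> p * \<rho> \<gamma> p $ i"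
          by (simp add: markov_op_def)
      qed
    qed
    moreover have "(fun_norm G (\<lambda>\<gamma>. \<rho> \<gamma> p $ i))\<^sup>2 = real (order G) / real CARD('k)" for i
      using order by (simp add: fun_norm_def inner)
    moreover have "norm (\<rho> \<gamma> p) = 1" if "\<gamma> \<in> carrier G" for \<gamma>
      using orthogonal_transformation_norm[OF W.\<rho>_orthogonal[OF that]] norm by simp
    moreover have "norm (p - reflection (n j) p) = 2 * \<alpha> j * root_det n" for j
      using np[of j] \<alpha>[of j] by (simp add: W.norm_diff_reflection)
    ultimately show ?thesis
      unfolding Let_def vec_lambda_eta
      by (intro conjI allI impI ballI W.orbit_map_inj[OF np] W.dist_edge image_subsetI)
        (simp_all add: inner)
  qed
  show ?thesis
    by (rule exI[of _ \<Psi>], rule exI[of _ \<Lambda>],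
        intro conjI allI impI smooth_\<Psi> bij smooth_\<Lambda> range_\<Lambda> analytic)
      (elim conjE, rule evaluation)
qed

end
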